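(* Assume that $\ell^*(\cdot,b):\mathbb{R}^s\to\mathbb{R}$ is $L_{\ell^*}$-smooth and convex and that $r(x)=\sum_{i=1}^nr_i(x_i)$ is $L_r$-smooth and convex. Let the sequence be generated by the algorithm described in the context, from any starting point $(x^0,y^0)\in\mathbb{R}^{d+s}$, with stepsize $$\gamma=\frac12\min\left\{1;\ \frac1{\sqrt{\lambda_{\max}(A^TA)}};\ \frac1{L_r};\ \frac1{L_{\ell^*}}\right\}.$$ Then there is an absolute constant $C>0$ such that for every $K\ge1$ $$\mathrm{gap}_2(\bar x^K,\bar y^K)\le C\,\frac{\left(1+\sqrt{\lambda_{\max}(A^TA)}+L_{\ell^*}+L_r\right)\hat D^2}{K},$$ where $\bar x^K=\frac1K\sum_{k=0}^{K-1}x^{k+1/2}$, $\bar y^K=\frac1K\sum_{k=0}^{K-1}y^{k+1/2}$ and $\hat D^2=\max_{x\in\mathcal X,y\in\mathcal Y}\left[\|x^0-x\|^2+\|y^0-y\|^2\right]$.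
   Context: Setting: $n,s,d_1,\dots,d_n$ are positive integers, $d=\sum_i d_i$, $A_i\in\mathbb{R}^{s\times d_i}$, $A=[A_1,\dots,A_n]\in\mathbb{R}^{s\times d}$, $b\in\mathbb{R}^s$ is fixed, and $x=(x_1,\dots,x_n)\in\mathbb{R}^d$ with $x_i\in\mathbb{R}^{d_i}$, so $Ax=\sum_iA_ix_i$; $r_i:\mathbb{R}^{d_i}\to\mathbb{R}$. For the loss $\ell:\mathbb{R}^s\times\mathbb{R}^s\to\mathbb{R}$, the dual function is $\ell^*(y,b)=\max_{z\in\mathbb{R}^s}\{\langle z,y\rangle-\ell(z,b)\}$, and $\nabla\ell^*(y,b)$ is its gradient in $y$. The saddle point problem is $\min_{x\in\mathbb{R}^d}\max_{y\in\mathbb{R}^s}\hat L(x,y)$ with $$\hat L(x,y)=-\ell^*(y,b)+\sum_{i=1}^nr_i(x_i)+y^T\Big(\sum_{i=1}^nA_ix_i\Big).$$ $\mathcal X\subset\mathbb{R}^d$, $\mathcal Y\subset\mathbb{R}^s$ are nonempty compact sets used only to define the criterion $$\mathrm{gap}_2(x,y)=\max_{\tilde y\in\mathcal Y}\hat L(x,\tilde y)-\min_{\tilde x\in\mathcal X}\hat L(\tilde x,y).$$ A function $f$ is $L$-smooth ($L>0$) if it is differentiable and $\|\nabla f(u)-\nabla f(v)\|\le L\|u-v\|$ for all $u,v$. Norms are Euclidean; $\lambda_{\max}$ is the largest eigenvalue; $1/0=+\infty$. Algorithm: for $k=0,\dots,K-1$, $x_i^{k+1/2}=x_i^k-\gamma(A_i^Ty^k+\nabla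 r_i(x_i^k))$ for all $i$; $y^{k+1/2}=y^k-\gamma(\nabla\ell^*(y^k,b)-\sum_iA_ix_i^k)$; $x_i^{k+1}=x_i^k-\gamma(A_i^Ty^{k+1/2}+\nabla r_i(x_i^{k+1/2}))$ for all $i$; $y^{k+1}=y^k-\gamma(\nabla\ell^*(y^{k+1/2},b)-\sum_iA_ix_i^{k+1/2})$. *)

theory Defs
  imports
    "HOL-Analysis.Abstract_Euclidean_Space"
    "HOL-Analysis.L2_Norm"
    "HOL-Library.Extended_Real"
    "Jordan_Normal_Form.Spectral_Radius"
begin

text \<open>
  The space \<open>\<real>\<^sup>m\<close> is \<^term>\<open>carrier_vec m :: real vec set\<close>. Dimensions are natural numbers rather
  than types, so that a constant can be chosen uniformly in all dimensions.
  Indices are zero-based.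
\<close>

unbundle no inner_syntax
unbundle no vec_syntax

definition vnorm :: "real vec \<Rightarrow> real" where
  "vnorm v = L2_set (\<lambda>i. v $ i) {..<dim_vec v}"

(* Frechet differentiability of f : R^m -> R at u, with the derivative represented by g *)
definition has_gradient :: "nat \<Rightarrow> (real vec \<Rightarrow> real) \<Rightarrow> real vec \<Rightarrow> real vec \<Rightarrow> bool" where
  "has_gradient m f g u \<longleftrightarrow> g \<in> carrier_vec m \<and>
     (\<forall>\<epsilon>>0. \<exists>\<delta>>0. \<forall>v\<in>carrier_vec m. vnorm (v - u) < \<delta> \<longrightarrow>
        \<bar>f v - f u - g \<bullet> (v - u)\<bar> \<le> \<epsilon> * vnorm (v - u))"

definition gradient :: "nat \<Rightarrow> (real vec \<Rightarrow> real) \<Rightarrow> real vec \<Rightarrow> real vec" where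
  "gradient m f u = (THE g. has_gradient m f g u)"

definition L_smooth :: "nat \<Rightarrow> real \<Rightarrow> (real vec \<Rightarrow> real) \<Rightarrow> bool" where
  "L_smooth m L f \<longleftrightarrow> L > 0 \<and>
     (\<forall>u\<in>carrier_vec m. \<exists>g. has_gradient m f g u) \<and>
     (\<forall>u\<in>carrier_vec m. \<forall>v\<in>carrier_vec m.
        vnorm (gradient m f u - gradient m f v) \<le> L * vnorm (u - v))"

definition vconvex :: "nat \<Rightarrow> (real vec \<Rightarrow> real) \<Rightarrow> bool" where
  "vconvex m f \<longleftrightarrow>
     (\<forall>u\<in>carrier_vec m. \<forall>v\<in>carrier_vec m. \<forall>t\<in>{0..1}.
        f ((1 - t) \<cdot>\<^sub>v u + t \<cdot>\<^sub>v v) \<le> (1 - t) * f u + t * f v)"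

(* The library's topological space R^m consists of real sequences vanishing from index m on. *)
definition vcompact :: "nat \<Rightarrow> real vec set \<Rightarrow> bool" where
  "vcompact m S \<longleftrightarrow> S \<subseteq> carrier_vec m \<and>
     compactin (Euclidean_space m) ((\<lambda>v i. if i < m then v $ i else 0) ` S)"

text \<open>
  For block sizes \<open>d 0, \<dots>, d (n - 1)\<close>, the vector \<open>x = (x\<^sub>0, \<dots>, x\<^bsub>n-1\<^esub>)\<close> is stored as one vector of
  dimension \<^term>\<open>total_dim n d\<close>, and \<open>x\<^sub>i\<close> is \<^term>\<open>block d i x\<close>.
\<close>

definition total_dim :: "nat \<Rightarrow> (nat \<Rightarrow> nat) \<Rightarrow> nat" where
  "total_dim n d = (\<Sum>i<n. d i)"

definition block :: "(nat \<Rightarrow> nat) \<Rightarrow> nat \<Rightarrow> real vec \<Rightarrow> real vec" where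
  "block d i x = vec (d i) (\<lambda>j. x $ ((\<Sum>k<i. d k) + j))"

(* [A_0, ..., A_(n-1)] *)
definition concat_mat :: "nat \<Rightarrow> nat \<Rightarrow> (nat \<Rightarrow> real mat) \<Rightarrow> real mat" where
  "concat_mat n s A = mat_of_cols s (concat (map (\<lambda>i. cols (A i)) [0..<n]))"

definition block_mult :: "nat \<Rightarrow> nat \<Rightarrow> (nat \<Rightarrow> nat) \<Rightarrow> (nat \<Rightarrow> real mat) \<Rightarrow> real vec \<Rightarrow> real vec" where
  "block_mult n s d A x = finsum_vec TYPE(real) s (\<lambda>i. A i *\<^sub>v block d i x) {..<n}"

definition separable_sum :: "nat \<Rightarrow> (nat \<Rightarrow> nat) \<Rightarrow> (nat \<Rightarrow> real vec \<Rightarrow> real) \<Rightarrow> real vec \<Rightarrow> real" where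
  "separable_sum n d r x = (\<Sum>i<n. r i (block d i x))"

definition lambda_max :: "real mat \<Rightarrow> real" where
  "lambda_max M = Max (spectrum M)"

(* The real supremum is meaningful only if the set is bounded above; see dual_finite. *)
definition dual :: "nat \<Rightarrow> (real vec \<Rightarrow> real vec \<Rightarrow> real) \<Rightarrow> real vec \<Rightarrow> real vec \<Rightarrow> real" where
  "dual s l b y = (SUP z\<in>carrier_vec s. z \<bullet> y - l z b)"

definition dual_finite :: "nat \<Rightarrow> (real vec \<Rightarrow> real vec \<Rightarrow> real) \<Rightarrow> real vec \<Rightarrow> bool" where
  "dual_finite s l b \<longleftrightarrow>
     (\<forall>y\<in>carrier_vec s. bdd_above ((\<lambda>z. z \<bullet> y - l z b) ` carrier_vec s))"

text \<open>In the next definitions \<open>g\<close> stands for the function \<open>\<ell>\<^sup>*(\<cdot>, b)\<close>.\<close>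

definition saddle ::
    "nat \<Rightarrow> nat \<Rightarrow> (nat \<Rightarrow> nat) \<Rightarrow> (nat \<Rightarrow> real mat) \<Rightarrow> (nat \<Rightarrow> real vec \<Rightarrow> real) \<Rightarrow>
     (real vec \<Rightarrow> real) \<Rightarrow> real vec \<Rightarrow> real vec \<Rightarrow> real" where
  "saddle n s d A r g x y = - g y + separable_sum n d r x + y \<bullet> block_mult n s d A x"

(* For compact nonempty X, Y and differentiable data, these suprema and infima are attained. *)
definition gap2 ::
    "(real vec \<Rightarrow> real vec \<Rightarrow> real) \<Rightarrow> real vec set \<Rightarrow> real vec set \<Rightarrow> real vec \<Rightarrow> real vec \<Rightarrow> real" where
  "gap2 L X Y x y = (SUP y'\<in>Y. L x y') - (INF x'\<in>X. L x' y)"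

definition sq_diameter ::
    "real vec set \<Rightarrow> real vec set \<Rightarrow> real vec \<Rightarrow> real vec \<Rightarrow> real" where
  "sq_diameter X Y x0 y0 = (SUP (x, y)\<in>X \<times> Y. (vnorm (x0 - x))\<^sup>2 + (vnorm (y0 - y))\<^sup>2)"

(* Extended reals give 1 / 0 = \<infinity>, which matters when lam = 0. *)
definition stepsize :: "real \<Rightarrow> real \<Rightarrow> real \<Rightarrow> real" where
  "stepsize lam Lr Ll =
     1 / 2 * real_of_ereal (Min {1, 1 / ereal (sqrt lam), 1 / ereal Lr, 1 / ereal Ll})"

(* xh k and yh k are the half-step iterates with index k + 1/2. *)
definition extragradient ::
    "nat \<Rightarrow> nat \<Rightarrow> (nat \<Rightarrow> nat) \<Rightarrow> (nat \<Rightarrow> real mat) \<Rightarrow> (nat \<Rightarrow> real vec \<Rightarrow> real) \<Rightarrow>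
     (real vec \<Rightarrow> real) \<Rightarrow> real \<Rightarrow> nat \<Rightarrow>
     (nat \<Rightarrow> real vec) \<Rightarrow> (nat \<Rightarrow> real vec) \<Rightarrow> (nat \<Rightarrow> real vec) \<Rightarrow> (nat \<Rightarrow> real vec) \<Rightarrow> bool" where
  "extragradient n s d A r g \<gamma> K x xh y yh \<longleftrightarrow>
     (\<forall>k\<le>K. x k \<in> carrier_vec (total_dim n d) \<and> y k \<in> carrier_vec s) \<and>
     (\<forall>k<K. xh k \<in> carrier_vec (total_dim n d) \<and> yh k \<in> carrier_vec s \<and>
        (\<forall>i<n. block d i (xh k) = block d i (x k) - \<gamma> \<cdot>\<^sub>v
           (transpose_mat (A i) *\<^sub>v y k + gradient (d i) (r i) (block d i (x k)))) \<and>
        yh k = y k - \<gamma> \<cdot>\<^sub>v (gradient s g (y k) - block_mult n s d A (x k)) \<and>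
        (\<forall>i<n. block d i (x (Suc k)) = block d i (x k) - \<gamma> \<cdot>\<^sub>v
           (transpose_mat (A i) *\<^sub>v yh k + gradient (d i) (r i) (block d i (xh k)))) \<and>
        y (Suc k) = y k - \<gamma> \<cdot>\<^sub>v (gradient s g (yh k) - block_mult n s d A (xh k)))"

definition vec_average :: "nat \<Rightarrow> nat \<Rightarrow> (nat \<Rightarrow> real vec) \<Rightarrow> real vec" where
  "vec_average m K v = (1 / real K) \<cdot>\<^sub>v finsum_vec TYPE(real) m v {..<K}"

end

theory Submission
  imports Defs
begin

text \<open>
  Write \<open>z = (x, y)\<close>, let \<open>A\<close> be the concatenated matrix and
  \<open>F z = (A\<^sup>T y + \<nabla>r x, \<nabla>\<ell>\<^sup>* y - A x)\<close>. One step of the method is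
  \<open>z\<^sub>h = z - \<gamma> F z\<close>, \<open>z' = z - \<gamma> F z\<^sub>h\<close>, and expanding squares gives for every \<open>w\<close>
  \<open>2 \<gamma> (F z\<^sub>h \<bullet> (z\<^sub>h - w)) = |z - w|\<^sup>2 - |z' - w|\<^sup>2 + \<gamma>\<^sup>2 |F z\<^sub>h - F z|\<^sup>2 - |z\<^sub>h - z|\<^sup>2\<close>.
  The stepsize makes \<open>\<gamma> F\<close> nonexpansive, so the last two terms are together nonpositive. By convexity
  \<open>F z\<^sub>h \<bullet> (z\<^sub>h - w)\<close> dominates the saddle gap at \<open>w\<close>; telescoping and Jensen's inequality
  bound the gap of the averages by \<open>|z\<^sub>0 - w|\<^sup>2 / (2 \<gamma> K)\<close>. Since
  \<open>1 / (2 \<gamma>) = max {1, sqrt \<lambda>, L\<^sub>r, L\<^sub>\<ell>}\<close>, the constant \<open>C = 1\<close> works.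
\<close>

section \<open>Euclidean vectors\<close>

lemma vnorm_sq: "(vnorm v)\<^sup>2 = v \<bullet> v"
  by (simp add: vnorm_def L2_set_def sum_nonneg scalar_prod_def power2_eq_square lessThan_atLeast0)

lemma vnorm_nonneg [simp]: "0 \<le> vnorm v"
  by (simp add: vnorm_def)

lemma vnorm_smult: "vnorm (t \<cdot>\<^sub>v v) = \<bar>t\<bar> * vnorm v"
proof -
  have "(vnorm (t \<cdot>\<^sub>v v))\<^sup>2 = (\<bar>t\<bar> * vnorm v)\<^sup>2"
    by (simp add: vnorm_sq power_mult_distrib scalar_prod_def sum_distrib_left algebra_simps power2_eq_square[of t])
  then show ?thesis by (simp only: power2_eq_iff_nonneg vnorm_nonneg abs_ge_zero mult_nonneg_nonneg)
qed

lemma abs_scalar_prod_le: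
  assumes "u \<in> carrier_vec m" "v \<in> carrier_vec m"
  shows "\<bar>u \<bullet> v\<bar> \<le> vnorm u * vnorm v"
proof -
  have "\<bar>u \<bullet> v\<bar> \<le> (\<Sum>i\<in>{0..<m}. \<bar>u $ i\<bar> * \<bar>v $ i\<bar>)"
    using assms unfolding scalar_prod_def
    by (auto intro!: order_trans[OF sum_abs] sum_mono simp: abs_mult)
  also have "\<dots> \<le> vnorm u * vnorm v"
    using L2_set_mult_ineq[of "\<lambda>i. u $ i" "\<lambda>i. v $ i" "{0..<m}"] assms
    by (simp add: vnorm_def lessThan_atLeast0)
  finally show ?thesis .
qed

text \<open>Coordinatewise this is \<open>(x - y)\<^sup>2 \<ge> 0\<close>. Squared norms are kept
  throughout, so this form replaces the triangle inequality; its factors 2 are later absorbed by the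
  1/2 in the stepsize.\<close>

lemma vnorm_add_sq_le:
  assumes "u \<in> carrier_vec m" "v \<in> carrier_vec m"
  shows "(vnorm (u + v))\<^sup>2 \<le> 2 * (vnorm u)\<^sup>2 + 2 * (vnorm v)\<^sup>2"
proof -
  have *: "(x + y) * (x + y) \<le> 2 * (x * x) + 2 * (y * y)" for x y :: real
    using zero_le_square[of "x - y"] by (simp add: algebra_simps)
  have dims: "dim_vec u = m" "dim_vec v = m" using assms by auto
  have "(vnorm (u + v))\<^sup>2 = (\<Sum>i\<in>{0..<m}. (u $ i + v $ i) * (u $ i + v $ i))"
    by (simp add: vnorm_sq scalar_prod_def dims)
  also have "\<dots> \<le> (\<Sum>i\<in>{0..<m}. 2 * (u $ i * u $ i) + 2 * (v $ i * v $ i))"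
    by (rule sum_mono) (rule *)
  also have "\<dots> = 2 * (vnorm u)\<^sup>2 + 2 * (vnorm v)\<^sup>2"
    by (simp add: vnorm_sq scalar_prod_def dims sum.distrib sum_distrib_left)
  finally show ?thesis .
qed

lemma vnorm_minus_commute:
  assumes "u \<in> carrier_vec m" "v \<in> carrier_vec m"
  shows "vnorm (u - v) = vnorm (v - u)"
proof -
  have "u - v = (-1) \<cdot>\<^sub>v (v - u)" using assms by (intro eq_vecI) auto
  then show ?thesis by (simp add: vnorm_smult)
qed

lemma vnorm_eq_0D:
  fixes v :: "real vec"
  assumes "v \<in> carrier_vec m" "v \<bullet> v = 0"
  shows "v = 0\<^sub>v m"
proof (rule eq_vecI)
  fix i assume i: "i < dim_vec (0\<^sub>v m :: real vec)"
  have "(\<Sum>i\<in>{0..<m}. v $ i * v $ i) = 0"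
    using assms by (simp add: scalar_prod_def)
  then have "\<forall>i\<in>{0..<m}. v $ i * v $ i = 0"
    by (simp add: sum_nonneg_eq_0_iff)
  then show "v $ i = 0\<^sub>v m $ i" using i by simp
qed (use assms in auto)

lemma vec_average_carrier [simp]:
  assumes "\<And>k. k < K \<Longrightarrow> w k \<in> carrier_vec m"
  shows "vec_average m K w \<in> carrier_vec m"
  unfolding vec_average_def using assms by (simp add: finsum_vec_closed Pi_def)

text \<open>Averages enter the later estimates through linear functionals and Jensen's inequality,
  and both rest on this exchange of the two finite sums.\<close>

lemma scalar_prod_vec_average:
  assumes "v \<in> carrier_vec m" "\<And>k. k < K \<Longrightarrow> w k \<in> carrier_vec m"
  shows "v \<bullet> vec_average m K w = (\<Sum>k<K. v \<bullet> w k) / real K"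
proof -
  have c: "finsum_vec TYPE(real) m w {..<K} \<in> carrier_vec m"
    using assms by (intro finsum_vec_closed) auto
  have "v \<bullet> finsum_vec TYPE(real) m w {..<K} = (\<Sum>i\<in>{0..<m}. \<Sum>k<K. v $ i * w k $ i)"
    unfolding scalar_prod_def carrier_vecD[OF c]
  proof (rule sum.cong[OF refl])
    fix i assume "i \<in> {0..<m}"
    then have "finsum_vec TYPE(real) m w {..<K} $ i = (\<Sum>k<K. w k $ i)"
      using assms(2) by (intro index_finsum_vec) auto
    then show "v $ i * finsum_vec TYPE(real) m w {..<K} $ i = (\<Sum>k<K. v $ i * w k $ i)"
      by (simp only: sum_distrib_left)
  qed
  also have "\<dots> = (\<Sum>k<K. \<Sum>i\<in>{0..<m}. v $ i * w k $ i)"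
    by (rule sum.swap)
  also have "\<dots> = (\<Sum>k<K. v \<bullet> w k)"
    using carrier_vecD[OF assms(2)] by (simp add: scalar_prod_def)
  finally show ?thesis
    unfolding vec_average_def by (simp add: scalar_prod_smult_distrib[OF assms(1) c])
qed

section \<open>Gradients\<close>

text \<open>Restricting the Frechet condition to a line through \<open>u\<close> yields one usable
  step for each \<epsilon>, so directional derivatives need no limit process.\<close>

lemma has_gradient_along_line:
  assumes "has_gradient m f g u" and [simp]: "u \<in> carrier_vec m" "w \<in> carrier_vec m"
    and "\<epsilon> > 0"
  shows "\<exists>t>0. t \<le> 1 \<and> \<bar>f (u + t \<cdot>\<^sub>v w) - f u - t * (g \<bullet> w)\<bar> \<le> \<epsilon> * t"
proof -
  have g [simp]: "g \<in> carrier_vec m" using assms(1) by (simp add: has_gradient_def)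
  \<comment> \<open>The summand 1 keeps the divisor positive when \<open>w\<close> is zero.\<close>
  define N where "N = 1 + vnorm w"
  have N: "N > 0" using vnorm_nonneg[of w] by (simp add: N_def add_pos_nonneg)
  have "\<epsilon> / N > 0" using assms(4) N by simp
  then obtain \<delta> where \<delta>: "\<delta> > 0" and diff: "\<And>v. v \<in> carrier_vec m \<Longrightarrow> vnorm (v - u) < \<delta> \<Longrightarrow>
      \<bar>f v - f u - g \<bullet> (v - u)\<bar> \<le> \<epsilon> / N * vnorm (v - u)"
    using assms(1) unfolding has_gradient_def by meson
  \<comment> \<open>The second entry gives \<open>t * vnorm w \<le> \<delta> / 2\<close>; the cap 1
    keeps the point on the segment when convexity is applied.\<close>
  define t where "t = min 1 (\<delta> / (2 * N))"
  have t: "t > 0" "t \<le> 1" using \<delta> N by (auto simp: t_def)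
  have e: "u + t \<cdot>\<^sub>v w - u = t \<cdot>\<^sub>v w"
    by (rule eq_vecI) (simp_all add: carrier_vecD[OF assms(2)] carrier_vecD[OF assms(3)])
  have tn: "t * vnorm w \<le> t * N" using t by (simp add: N_def)
  have "t * N \<le> \<delta> / (2 * N) * N" using N by (intro mult_right_mono) (auto simp: t_def)
  then have "t * vnorm w < \<delta>" using tn N \<delta> by simp
  then have "\<bar>f (u + t \<cdot>\<^sub>v w) - f u - g \<bullet> (t \<cdot>\<^sub>v w)\<bar> \<le> \<epsilon> / N * (t * vnorm w)"
    using diff[of "u + t \<cdot>\<^sub>v w"] t by (simp add: e vnorm_smult)
  also have "\<dots> \<le> \<epsilon> / N * (t * N)" by (rule mult_left_mono[OF tn]) (use assms(4) N in simp)
  finally show ?thesis using t N scalar_prod_smult_distrib[OF g assms(3)]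
    by (intro exI[of _ t]) simp
qed

text \<open>Along the direction \<open>g - h\<close> the two linear approximations separate at a
  linear rate, which exceeds the sum of their errors for small \<epsilon>. Uniqueness makes the
  definite description in \<open>gradient\<close> denote.\<close>

lemma has_gradient_unique:
  assumes "has_gradient m f g u" "has_gradient m f h u" and [simp]: "u \<in> carrier_vec m"
  shows "g = h"
proof -
  have [simp]: "g \<in> carrier_vec m" "h \<in> carrier_vec m"
    using assms by (auto simp: has_gradient_def)
  define w where "w = g - h"
  have [simp]: "w \<in> carrier_vec m" by (simp add: w_def)
  have "w \<bullet> w = 0"
  proof (rule ccontr)
    assume "w \<bullet> w \<noteq> 0"
    then have pos: "w \<bullet> w > 0" by (metis vnorm_sq zero_le_power2 less_eq_real_def)
    define N where "N = 1 + vnorm w"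
    have N: "N > 0" using vnorm_nonneg[of w] by (simp add: N_def add_pos_nonneg)
    \<comment> \<open>Chosen so that the two errors together, at most
      \<open>2 * \<epsilon> * t * N\<close>, are half of the separation
      \<open>t * (w \<bullet> w)\<close>.\<close>
    define \<epsilon> where "\<epsilon> = (w \<bullet> w) / (4 * N)"
    have \<epsilon>: "\<epsilon> > 0" using pos N by (simp add: \<epsilon>_def)
    obtain \<delta>1 where \<delta>1: "\<delta>1 > 0" "\<And>v. v \<in> carrier_vec m \<Longrightarrow> vnorm (v - u) < \<delta>1 \<Longrightarrow>
        \<bar>f v - f u - g \<bullet> (v - u)\<bar> \<le> \<epsilon> * vnorm (v - u)"
      using assms(1) \<epsilon> unfolding has_gradient_def by meson
    obtain \<delta>2 where \<delta>2: "\<delta>2 > 0" "\<And>v. v \<in> carrier_vec m \<Longrightarrow> vnorm (v - u) < \<delta>2 \<Longrightarrow>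
        \<bar>f v - f u - h \<bullet> (v - u)\<bar> \<le> \<epsilon> * vnorm (v - u)"
      using assms(2) \<epsilon> unfolding has_gradient_def by meson
    define t where "t = min \<delta>1 \<delta>2 / (2 * N)"
    have t: "t > 0" using \<delta>1 \<delta>2 N by (simp add: t_def)
    have tN: "t * N = min \<delta>1 \<delta>2 / 2" using N by (simp add: t_def)
    have tn: "t * vnorm w \<le> t * N" using t by (simp add: N_def)
    have e: "u + t \<cdot>\<^sub>v w - u = t \<cdot>\<^sub>v w"
      by (rule eq_vecI) (simp_all add: carrier_vecD[OF assms(3)] carrier_vecD[OF \<open>w \<in> carrier_vec m\<close>])
    have a: "\<bar>f (u + t \<cdot>\<^sub>v w) - f u - g \<bullet> (t \<cdot>\<^sub>v w)\<bar> \<le> \<epsilon> * (t * vnorm w)"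
      using \<delta>1(2)[of "u + t \<cdot>\<^sub>v w"] tn tN \<delta>1(1) \<delta>2(1) t by (simp add: e vnorm_smult)
    have b: "\<bar>f (u + t \<cdot>\<^sub>v w) - f u - h \<bullet> (t \<cdot>\<^sub>v w)\<bar> \<le> \<epsilon> * (t * vnorm w)"
      using \<delta>2(2)[of "u + t \<cdot>\<^sub>v w"] tn tN \<delta>1(1) \<delta>2(1) t by (simp add: e vnorm_smult)
    have "w \<bullet> w = g \<bullet> w - h \<bullet> w"
      unfolding w_def by (subst minus_scalar_prod_distrib[of _ m]) auto
    then have "t * (w \<bullet> w) = g \<bullet> (t \<cdot>\<^sub>v w) - h \<bullet> (t \<cdot>\<^sub>v w)"
      by (simp add: scalar_prod_smult_distrib[of _ m] right_diff_distrib)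
    also have "\<dots> \<le> 2 * (\<epsilon> * (t * vnorm w))" using a b by linarith
    also have "\<dots> \<le> 2 * (\<epsilon> * (t * N))" using tn \<epsilon> by simp
    also have "\<dots> = t * (w \<bullet> w) / 2" using N by (simp add: \<epsilon>_def)
    finally show False using t pos by simp
  qed
  then have "w = 0\<^sub>v m" by (intro vnorm_eq_0D) auto
  show ?thesis
  proof (rule eq_vecI)
    fix i assume "i < dim_vec h"
    then have "i < m" using carrier_vecD[OF \<open>h \<in> carrier_vec m\<close>] by simp
    then have "w $ i = 0" using \<open>w = 0\<^sub>v m\<close> by simp
    then show "g $ i = h $ i" using \<open>i < dim_vec h\<close> by (simp add: w_def)
  qed (metis \<open>g \<in> carrier_vec m\<close> \<open>h \<in> carrier_vec m\<close> carrier_vecD)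
qed

lemma gradient_eqI:
  assumes "has_gradient m f g u" "u \<in> carrier_vec m"
  shows "gradient m f u = g"
  unfolding gradient_def using assms has_gradient_unique by blast

lemma L_smooth_has_gradient:
  assumes "L_smooth m L f" "u \<in> carrier_vec m"
  shows "has_gradient m f (gradient m f u) u"
  using assms gradient_eqI unfolding L_smooth_def by metis

lemma gradient_carrier:
  assumes "L_smooth m L f" "u \<in> carrier_vec m"
  shows "gradient m f u \<in> carrier_vec m"
  using L_smooth_has_gradient[OF assms] by (simp add: has_gradient_def)

text \<open>Convexity bounds the increment at parameter \<open>t\<close> by
  \<open>t * (f v - f u)\<close>, and the gradient predicts it up to \<open>\<epsilon> * t\<close>;
  dividing by \<open>t\<close> leaves the tangent inequality with error \<epsilon>.\<close>

lemma vconvex_gradient_le: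
  assumes "vconvex m f" "has_gradient m f g u"
    and [simp]: "u \<in> carrier_vec m" "v \<in> carrier_vec m"
  shows "f u + g \<bullet> (v - u) \<le> f v"
proof (rule field_le_epsilon)
  fix \<epsilon> :: real assume \<epsilon>: "\<epsilon> > 0"
  obtain t where t: "t > 0" "t \<le> 1"
    and d: "\<bar>f (u + t \<cdot>\<^sub>v (v - u)) - f u - t * (g \<bullet> (v - u))\<bar> \<le> \<epsilon> * t"
    using has_gradient_along_line[OF assms(2), of "v - u" \<epsilon>] \<epsilon> by auto
  have "u + t \<cdot>\<^sub>v (v - u) = (1 - t) \<cdot>\<^sub>v u + t \<cdot>\<^sub>v v"
    by (rule eq_vecI) (simp_all add: carrier_vecD[OF assms(3)] carrier_vecD[OF assms(4)] algebra_simps)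
  moreover have "f ((1 - t) \<cdot>\<^sub>v u + t \<cdot>\<^sub>v v) \<le> (1 - t) * f u + t * f v"
    using assms(1) t by (simp add: vconvex_def)
  ultimately have "t * (g \<bullet> (v - u)) \<le> t * (f v - f u + \<epsilon>)"
    using d by (simp add: algebra_simps)
  then show "f u + g \<bullet> (v - u) \<le> f v + \<epsilon>" using t by simp
qed

text \<open>Jensen's inequality from the supporting hyperplane at the average: the deviations from
  the average sum to zero, so the linear terms cancel and no induction on convex combinations is
  required.\<close>

lemma vconvex_vec_average_le:
  assumes "vconvex m f" "L_smooth m L f" "K > 0"
    and w: "\<And>k. k < K \<Longrightarrow> w k \<in> carrier_vec m"
  shows "f (vec_average m K w) \<le> (\<Sum>k<K. f (w k)) / real K"
proof -
  define a where "a = vec_average m K w"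
  define g where "g = gradient m f a"
  have a: "a \<in> carrier_vec m" using w by (simp add: a_def)
  have hg: "has_gradient m f g a"
    unfolding g_def by (rule L_smooth_has_gradient[OF assms(2) a])
  then have g: "g \<in> carrier_vec m" by (simp add: has_gradient_def)
  have "(\<Sum>k<K. g \<bullet> (w k - a)) = (\<Sum>k<K. g \<bullet> w k) - real K * (g \<bullet> a)"
    using w by (simp add: scalar_prod_minus_distrib[OF g _ a] sum_subtractf)
  also have "\<dots> = 0"
    using scalar_prod_vec_average[OF g w] assms(3) by (simp add: a_def)
  finally have "real K * f a = (\<Sum>k<K. f a + g \<bullet> (w k - a))"
    by (simp add: sum.distrib)
  also have "\<dots> \<le> (\<Sum>k<K. f (w k))"
    using vconvex_gradient_le[OF assms(1) hg a] w by (intro sum_mono) auto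
  finally have "real K * f a \<le> (\<Sum>k<K. f (w k))" .
  then show ?thesis using assms(3) by (simp add: a_def field_simps)
qed

section \<open>The largest eigenvalue as a maximal Rayleigh quotient\<close>

text \<open>A continuous quadratic form attains its maximum on the compact unit sphere, and
  homogeneity extends the bound to all vectors. Compactness is obtained for functions on the
  naturals that vanish from \<open>m\<close> on, with \<open>Q\<close> and \<open>N\<close> as the
  transported form and squared norm.\<close>

lemma rayleigh_max_exists:
  fixes M :: "real mat"
  assumes M: "M \<in> carrier_mat m m" and "m > 0"
  shows "\<exists>v\<in>carrier_vec m. v \<bullet> v = 1 \<and>
    (\<forall>w\<in>carrier_vec m. w \<bullet> (M *\<^sub>v w) \<le> (v \<bullet> (M *\<^sub>v v)) * (w \<bullet> w))"
proof -
  define Q :: "(nat \<Rightarrow> real) \<Rightarrow> real" where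
    "Q = (\<lambda>f. \<Sum>i\<in>{0..<m}. f i * (\<Sum>j\<in>{0..<m}. M $$ (i, j) * f j))"
  define N :: "(nat \<Rightarrow> real) \<Rightarrow> real" where "N = (\<lambda>f. \<Sum>i\<in>{0..<m}. f i * f i)"
  \<comment> \<open>A cube containing the sphere, compact by Tychonoff; the factors
    \<open>{0}\<close> beyond \<open>m\<close> make its members correspond to vectors of dimension
    \<open>m\<close>.\<close>
  define B :: "(nat \<Rightarrow> real) set" where
    "B = Pi\<^sub>E UNIV (\<lambda>i. if i < m then {-1..1} else {0})"
  have Q_vec: "Q (\<lambda>i. if i < m then w $ i else 0) = w \<bullet> (M *\<^sub>v w)"
    and N_vec: "N (\<lambda>i. if i < m then w $ i else 0) = w \<bullet> w"
    if "w \<in> carrier_vec m" for w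
    using that M by (auto simp: Q_def N_def scalar_prod_def intro!: sum.cong)
  have Q_fun: "vec m f \<bullet> (M *\<^sub>v vec m f) = Q f"
    and N_fun: "vec m f \<bullet> vec m f = N f" for f
    using M by (auto simp: Q_def N_def scalar_prod_def intro!: sum.cong)
  have "compact B"
    using compactin_PiE[of "\<lambda>_::nat. euclideanreal" UNIV "\<lambda>i. if i < m then {-1..1} else {0}"]
    by (auto simp: B_def euclidean_product_topology)
  moreover have cont_N: "continuous_on UNIV N" and cont_Q: "continuous_on UNIV Q"
    unfolding N_def Q_def by (intro continuous_intros continuous_on_product_coordinates)+
  moreover have "closed {f. N f = 1}"
    using cont_N by (intro closed_Collect_eq) auto
  ultimately have cpt: "compact (B \<inter> {f. N f = 1})" by blast
  have in_sphere: "(\<lambda>i. if i < m then w $ i else 0) \<in> B \<inter> {f. N f = 1}"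
    if w: "w \<in> carrier_vec m" "w \<bullet> w = 1" for w
  proof -
    have "\<bar>w $ i\<bar> \<le> 1" if "i < m" for i
    proof -
      have "w $ i * w $ i \<le> (\<Sum>i\<in>{0..<m}. w $ i * w $ i)"
        using that by (intro member_le_sum) auto
      also have "\<dots> = 1" using w by (simp add: scalar_prod_def)
      finally show ?thesis by (simp add: abs_square_le_1 flip: power2_eq_square)
    qed
    then show ?thesis using N_vec[OF w(1)] w(2) by (force simp: B_def abs_le_iff)
  qed
  \<comment> \<open>The sphere is nonempty because the dimension is positive.\<close>
  have "unit_vec m 0 \<bullet> (unit_vec m 0 :: real vec) = 1" using \<open>m > 0\<close> by simp
  then have "B \<inter> {f. N f = 1} \<noteq> {}" using in_sphere[of "unit_vec m 0"] by auto
  then obtain f where f: "f \<in> B \<inter> {f. N f = 1}"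
    and max: "\<And>f'. f' \<in> B \<inter> {f. N f = 1} \<Longrightarrow> Q f' \<le> Q f"
    using continuous_attains_sup[OF cpt _ continuous_on_subset[OF cont_Q]] by auto
  show ?thesis
  proof (intro bexI[of _ "vec m f"] conjI ballI)
    show "vec m f \<bullet> vec m f = 1" using f by (simp add: N_fun)
    fix w :: "real vec" assume w: "w \<in> carrier_vec m"
    show "w \<bullet> (M *\<^sub>v w) \<le> (vec m f \<bullet> (M *\<^sub>v vec m f)) * (w \<bullet> w)"
    proof (cases "w \<bullet> w = 0")
      case True
      then have "w = 0\<^sub>v m" using vnorm_eq_0D w by blast
      moreover have "M *\<^sub>v 0\<^sub>v m \<in> carrier_vec m" using M by simp
      ultimately show ?thesis by simp
    next
      case False
      \<comment> \<open>Both sides are homogeneous of degree two, so \<open>w\<close> is normalised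
        to the unit sphere.\<close>
      define c where "c = vnorm w"
      have c2: "c * c = w \<bullet> w" using vnorm_sq[of w] by (simp add: c_def power2_eq_square)
      then have c: "c \<noteq> 0" using False by auto
      define w' where "w' = (1 / c) \<cdot>\<^sub>v w"
      have w': "w' \<in> carrier_vec m" using w by (simp add: w'_def)
      have ww: "w = c \<cdot>\<^sub>v w'" using c by (auto simp: w'_def intro!: eq_vecI)
      have cw: "w' \<bullet> w' = 1"
        using w c by (simp add: w'_def flip: c2)
      have "w' \<bullet> (M *\<^sub>v w') \<le> Q f"
        using max[OF in_sphere[OF w' cw]] Q_vec[OF w'] by simp
      then have "(c * c) * (w' \<bullet> (M *\<^sub>v w')) \<le> (c * c) * Q f"
        by (intro mult_left_mono) auto
      moreover have "w \<bullet> (M *\<^sub>v w) = (c * c) * (w' \<bullet> (M *\<^sub>v w'))"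
        unfolding ww using w' M by (simp add: mult_mat_vec[of M m m] scalar_prod_smult_distrib[of _ m]
            smult_scalar_prod_distrib[of _ m])
      ultimately show ?thesis using c2 by (simp add: Q_fun algebra_simps)
    qed
  qed simp
qed

text \<open>The quadratic form \<open>\<mu> (w \<bullet> w) - w \<bullet> M w\<close> is nonnegative and vanishes at a maximizer
  \<open>v\<close> of the Rayleigh quotient; perturbing \<open>v\<close> in the direction \<open>\<mu> v - M v\<close> shows that \<open>v\<close> is an
  eigenvector.\<close>

lemma symmetric_rayleigh_le_lambda_max:
  fixes M :: "real mat"
  assumes M: "M \<in> carrier_mat m m" and sym: "transpose_mat M = M" and "m > 0"
    and w: "w \<in> carrier_vec m"
  shows "w \<bullet> (M *\<^sub>v w) \<le> lambda_max M * (w \<bullet> w)"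
proof -
  obtain v where v: "v \<in> carrier_vec m" "v \<bullet> v = 1"
    and le: "\<And>w. w \<in> carrier_vec m \<Longrightarrow> w \<bullet> (M *\<^sub>v w) \<le> (v \<bullet> (M *\<^sub>v v)) * (w \<bullet> w)"
    using rayleigh_max_exists[OF M \<open>m > 0\<close>] by blast
  define \<mu> where "\<mu> = v \<bullet> (M *\<^sub>v v)"
  \<comment> \<open>The residual of the eigenvector equation; the aim is to show that it
    vanishes.\<close>
  define p where "p = \<mu> \<cdot>\<^sub>v v - M *\<^sub>v v"
  have Mv: "M *\<^sub>v v \<in> carrier_vec m" by (rule mult_mat_vec_carrier[OF M v(1)])
  have p: "p \<in> carrier_vec m" using v Mv by (simp add: p_def)
  have Mp: "M *\<^sub>v p \<in> carrier_vec m" by (rule mult_mat_vec_carrier[OF M p])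
  have vMp: "v \<bullet> (M *\<^sub>v p) = p \<bullet> (M *\<^sub>v v)"
    using transpose_vec_mult_scalar[OF M p v(1)] comm_scalar_prod[OF Mv p] sym by simp
  have pp: "p \<bullet> p = \<mu> * (p \<bullet> v) - p \<bullet> (M *\<^sub>v v)"
    using v Mv p by (subst (2) p_def) (simp add: scalar_prod_minus_distrib[of _ m])
  define q where "q = \<mu> * (p \<bullet> p) - p \<bullet> (M *\<^sub>v p)"
  have q: "0 \<le> q" using le[OF p] by (simp add: q_def \<mu>_def)
  \<comment> \<open>This is the nonnegative form at \<open>v + t \<cdot>\<^sub>v p\<close>. The
    constant term vanishes since \<open>v \<bullet> v = 1\<close>, symmetry merges the two cross
    terms, and \<open>pp\<close> turns the linear coefficient into
    \<open>2 * (p \<bullet> p)\<close>.\<close>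
  have ineq: "0 \<le> 2 * t * (p \<bullet> p) + t * t * q" for t
  proof -
    have tp: "t \<cdot>\<^sub>v p \<in> carrier_vec m" using p by simp
    define z where "z = v + t \<cdot>\<^sub>v p"
    have z: "z \<in> carrier_vec m" using v p by (simp add: z_def)
    have Mz: "M *\<^sub>v z = M *\<^sub>v v + t \<cdot>\<^sub>v (M *\<^sub>v p)"
      unfolding z_def using M v p by (simp add: mult_add_distrib_mat_vec[of _ m m] mult_mat_vec[of _ m m])
    have "z \<bullet> z = 1 + 2 * t * (p \<bullet> v) + t * t * (p \<bullet> p)"
      using v p tp comm_scalar_prod[OF v(1) p] unfolding z_def
      by (simp add: add_scalar_prod_distrib[of _ m] scalar_prod_add_distrib[of _ m] algebra_simps)
    moreover have "z \<bullet> (M *\<^sub>v z) = \<mu> + 2 * t * (p \<bullet> (M *\<^sub>v v)) + t * t * (p \<bullet> (M *\<^sub>v p))"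
      unfolding Mz using v p tp Mv Mp vMp unfolding z_def
      by (simp add: add_scalar_prod_distrib[of _ m] scalar_prod_add_distrib[of _ m] \<mu>_def)
    ultimately have "0 \<le> \<mu> * (1 + 2 * t * (p \<bullet> v) + t * t * (p \<bullet> p)) -
        (\<mu> + 2 * t * (p \<bullet> (M *\<^sub>v v)) + t * t * (p \<bullet> (M *\<^sub>v p)))"
      using le[OF z] by (simp add: \<mu>_def)
    then show ?thesis by (simp add: pp q_def algebra_simps)
  qed
  have "p \<bullet> p = 0"
  proof (rule ccontr)
    assume "p \<bullet> p \<noteq> 0"
    then have P: "p \<bullet> p > 0" by (metis vnorm_sq zero_le_power2 less_eq_real_def)
    \<comment> \<open>A small negative step makes the linear term dominate. With
      \<open>q + 1\<close> the divisor is positive even for \<open>q = 0\<close>, and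
      \<open>2 * (p \<bullet> p) + t * q\<close> equals \<open>p \<bullet> p - t\<close>, which is
      positive, whereas dividing \<open>ineq\<close> by \<open>t\<close> makes it
      nonpositive.\<close>
    define t where "t = - (p \<bullet> p) / (q + 1)"
    have t: "t < 0" "t * (q + 1) = - (p \<bullet> p)" using P q by (auto simp: t_def)
    have "0 \<le> t * (2 * (p \<bullet> p) + t * q)" using ineq[of t] by (simp add: algebra_simps)
    then have "2 * (p \<bullet> p) + t * q \<le> 0" using t(1) by (simp add: zero_le_mult_iff)
    then show False using t P by (simp add: algebra_simps)
  qed
  then have "p = 0\<^sub>v m" using vnorm_eq_0D p by blast
  then have "(\<mu> \<cdot>\<^sub>v v - M *\<^sub>v v) $ i = 0" if "i < m" for i
    using that by (simp add: p_def)
  then have "M *\<^sub>v v = \<mu> \<cdot>\<^sub>v v"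
    using v M by (intro eq_vecI) auto
  moreover have "v \<noteq> 0\<^sub>v m" using v by auto
  ultimately have "\<mu> \<in> spectrum M"
    using v M by (auto simp: spectrum_def eigenvalue_def eigenvector_def)
  then have "\<mu> \<le> lambda_max M"
    unfolding lambda_max_def by (rule Max_ge[OF card_finite_spectrum(1)[OF M]])
  moreover have "0 \<le> w \<bullet> w" by (simp flip: vnorm_sq)
  ultimately show ?thesis using le[OF w] mult_right_mono[of \<mu> "lambda_max M" "w \<bullet> w"] by (simp add: \<mu>_def)
qed

section \<open>Operator norm bounds for a matrix and its transpose\<close>

text \<open>The left side is the quadratic form of the symmetric Gram matrix, to which the Rayleigh
  bound applies.\<close>

lemma vnorm_mult_mat_vec_sq_le:
  fixes B :: "real mat"
  assumes B: "B \<in> carrier_mat s m" and "m > 0" and w: "w \<in> carrier_vec m"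
  shows "(vnorm (B *\<^sub>v w))\<^sup>2 \<le> lambda_max (transpose_mat B * B) * (vnorm w)\<^sup>2"
proof -
  have BT: "transpose_mat B \<in> carrier_mat m s" using B by simp
  have sym: "transpose_mat (transpose_mat B * B) = transpose_mat B * B"
    using transpose_mult[OF BT B] by simp
  have "B *\<^sub>v w \<in> carrier_vec s" by (rule mult_mat_vec_carrier[OF B w])
  then have "w \<bullet> ((transpose_mat B * B) *\<^sub>v w) = (B *\<^sub>v w) \<bullet> (B *\<^sub>v w)"
    using transpose_vec_mult_scalar[OF B w, of "B *\<^sub>v w"] assoc_mult_mat_vec[OF BT B w]
      comm_scalar_prod[OF w, of "transpose_mat B *\<^sub>v (B *\<^sub>v w)"] BT
    by (simp add: mult_mat_vec_carrier[OF BT])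
  then show ?thesis
    using symmetric_rayleigh_le_lambda_max[OF mult_carrier_mat[OF BT B] sym \<open>m > 0\<close> w]
    by (simp add: vnorm_sq)
qed

lemma lambda_max_gram_nonneg:
  fixes B :: "real mat"
  assumes B: "B \<in> carrier_mat s m" and "m > 0"
  shows "0 \<le> lambda_max (transpose_mat B * B)"
proof -
  have "(vnorm (unit_vec m 0))\<^sup>2 = 1" using \<open>m > 0\<close> by (simp add: vnorm_sq)
  then show ?thesis
    using vnorm_mult_mat_vec_sq_le[OF assms, of "unit_vec m 0"]
    by (metis mult.right_neutral order_trans unit_vec_carrier zero_le_power2)
qed

text \<open>The same eigenvalue serves the transpose by duality rather than through the spectrum of
  the other Gram matrix: for \<open>w = transpose_mat B *\<^sub>v y\<close>, Cauchy-Schwarz bounds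
  \<open>w \<bullet> w = y \<bullet> (B *\<^sub>v w)\<close>, and the common factor
  \<open>(vnorm w)\<^sup>2\<close> cancels after squaring.\<close>

lemma vnorm_mult_transpose_sq_le:
  fixes B :: "real mat"
  assumes B: "B \<in> carrier_mat s m" and "m > 0" and y: "y \<in> carrier_vec s"
  shows "(vnorm (transpose_mat B *\<^sub>v y))\<^sup>2 \<le> lambda_max (transpose_mat B * B) * (vnorm y)\<^sup>2"
proof -
  define w where "w = transpose_mat B *\<^sub>v y"
  define l where "l = lambda_max (transpose_mat B * B)"
  have l: "0 \<le> l" unfolding l_def by (rule lambda_max_gram_nonneg[OF B \<open>m > 0\<close>])
  have w: "w \<in> carrier_vec m" using B y by (auto simp: w_def)
  have Bw: "B *\<^sub>v w \<in> carrier_vec s" by (rule mult_mat_vec_carrier[OF B w])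
  have "w \<bullet> w = y \<bullet> (B *\<^sub>v w)"
    using transpose_vec_mult_scalar[OF B w y] by (simp add: w_def)
  then have "(vnorm w)\<^sup>2 \<le> vnorm y * vnorm (B *\<^sub>v w)"
    using abs_scalar_prod_le[OF y Bw] by (simp add: vnorm_sq)
  then have "((vnorm w)\<^sup>2)\<^sup>2 \<le> (vnorm y)\<^sup>2 * (vnorm (B *\<^sub>v w))\<^sup>2"
    by (metis power_mono power_mult_distrib zero_le_power2)
  also have "\<dots> \<le> (vnorm y)\<^sup>2 * (l * (vnorm w)\<^sup>2)"
    unfolding l_def by (intro mult_left_mono vnorm_mult_mat_vec_sq_le[OF B \<open>m > 0\<close> w]) simp
  finally have "(vnorm w)\<^sup>2 * (vnorm w)\<^sup>2 \<le> (l * (vnorm y)\<^sup>2) * (vnorm w)\<^sup>2"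
    by (simp add: power2_eq_square mult_ac)
  then have "(vnorm w)\<^sup>2 \<le> l * (vnorm y)\<^sup>2" if "vnorm w \<noteq> 0"
    using that by (metis mult_right_le_imp_le zero_less_power2)
  \<comment> \<open>For \<open>w\<close> of norm zero nothing can be cancelled, and the bound holds
    because \<open>l\<close> is nonnegative.\<close>
  then have "(vnorm w)\<^sup>2 \<le> l * (vnorm y)\<^sup>2"
    using l by (cases "vnorm w = 0") auto
  then show ?thesis by (simp add: w_def l_def)
qed

section \<open>Block vectors\<close>

lemma sum_lessThan_add:
  fixes f :: "nat \<Rightarrow> 'a::comm_monoid_add"
  shows "(\<Sum>k<a + b. f k) = (\<Sum>k<a. f k) + (\<Sum>j<b. f (a + j))"
  by (induction b) (auto simp: add.assoc)

lemma sum_lessThan_blocks: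
  fixes f :: "nat \<Rightarrow> 'a::comm_monoid_add" and n :: nat and d :: "nat \<Rightarrow> nat"
  shows "(\<Sum>k<(\<Sum>i<n. d i). f k) = (\<Sum>i<n. \<Sum>j<d i. f ((\<Sum>k<i. d k) + j))"
  by (induction n) (simp_all add: sum_lessThan_add)

lemma block_end_le:
  fixes d :: "nat \<Rightarrow> nat"
  assumes "i < n"
  shows "(\<Sum>k<i. d k) + d i \<le> (\<Sum>k<n. d k)"
proof -
  have "(\<Sum>k<Suc i. d k) \<le> (\<Sum>k<n. d k)"
    using assms by (intro sum_mono2) auto
  then show ?thesis by simp
qed

lemma block_index_less:
  assumes "i < n" "j < d i"
  shows "(\<Sum>k<i. d k) + j < total_dim n d"
  using block_end_le[OF assms(1), of d] assms(2) by (simp add: total_dim_def)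

lemma block_index_exists:
  assumes "k < total_dim n d"
  shows "\<exists>i<n. \<exists>j<d i. k = (\<Sum>l<i. d l) + j"
  using assms unfolding total_dim_def
proof (induction n)
  case (Suc n)
  show ?case
  proof (cases "k < (\<Sum>i<n. d i)")
    case True
    then show ?thesis using Suc.IH less_SucI by blast
  next
    case False
    then have "k = (\<Sum>l<n. d l) + (k - (\<Sum>l<n. d l))" "k - (\<Sum>l<n. d l) < d n"
      using Suc.prems by auto
    then show ?thesis by blast
  qed
qed simp

lemma dim_block [simp]: "dim_vec (block d i x) = d i"
  by (simp add: block_def)

lemma block_carrier [simp]: "block d i x \<in> carrier_vec (d i)"
  by (simp add: block_def)

lemma block_index: "j < d i \<Longrightarrow> block d i x $ j = x $ ((\<Sum>k<i. d k) + j)"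
  by (simp add: block_def)

lemma eq_vec_blocksI:
  assumes "u \<in> carrier_vec (total_dim n d)" "v \<in> carrier_vec (total_dim n d)"
    and "\<And>i. i < n \<Longrightarrow> block d i u = block d i v"
  shows "u = v"
proof (rule eq_vecI)
  fix k assume "k < dim_vec v"
  then have "k < total_dim n d" using assms(2) by simp
  then obtain i j where "i < n" "j < d i" "k = (\<Sum>l<i. d l) + j"
    using block_index_exists by blast
  then show "u $ k = v $ k" using assms(3)[of i] block_index[of j d i] by metis
qed (use assms in simp)

lemma block_minus:
  assumes "u \<in> carrier_vec (total_dim n d)" "v \<in> carrier_vec (total_dim n d)" "i < n"
  shows "block d i (u - v) = block d i u - block d i v"
  using assms block_index_less[OF assms(3)] by (intro eq_vecI) (simp_all add: block_index)

lemma block_add: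
  assumes "u \<in> carrier_vec (total_dim n d)" "v \<in> carrier_vec (total_dim n d)" "i < n"
  shows "block d i (u + v) = block d i u + block d i v"
  using assms block_index_less[OF assms(3)] by (intro eq_vecI) (simp_all add: block_index)

lemma block_smult:
  assumes "u \<in> carrier_vec (total_dim n d)" "i < n"
  shows "block d i (c \<cdot>\<^sub>v u) = c \<cdot>\<^sub>v block d i u"
  using assms block_index_less[OF assms(2)] by (intro eq_vecI) (simp_all add: block_index)

lemma scalar_prod_blocks:
  assumes "u \<in> carrier_vec (total_dim n d)" "v \<in> carrier_vec (total_dim n d)"
  shows "u \<bullet> v = (\<Sum>i<n. block d i u \<bullet> block d i v)"
  using assms sum_lessThan_blocks[of "\<lambda>k. u $ k * v $ k" d n]
  by (simp add: scalar_prod_def total_dim_def lessThan_atLeast0 block_index)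

section \<open>The concatenated matrix in block form\<close>

lemma length_concat_blocks: "length (concat (map f [0..<n])) = (\<Sum>i<n. length (f i))"
  by (induction n) auto

lemma nth_concat_blocks:
  assumes "i < n" "j < length (f i)"
  shows "concat (map f [0..<n]) ! ((\<Sum>k<i. length (f k)) + j) = f i ! j"
  using assms
proof (induction n)
  case (Suc n)
  show ?case
  proof (cases "i = n")
    case True
    then show ?thesis using Suc.prems by (simp add: nth_append length_concat_blocks[symmetric])
  next
    case False
    then have "(\<Sum>k<i. length (f k)) + j < length (concat (map f [0..<n]))"
      using block_end_le[of i n "\<lambda>i. length (f i)"] Suc.prems by (simp only: length_concat_blocks) simp
    then show ?thesis using Suc False by (simp add: nth_append)
  qed
qed simp

lemma
  assumes A: "\<And>i. i < n \<Longrightarrow> A i \<in> carrier_mat s (d i)"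
  shows concat_mat_carrier: "concat_mat n s A \<in> carrier_mat s (total_dim n d)"
    and concat_mat_index: "\<And>p i j. p < s \<Longrightarrow> i < n \<Longrightarrow> j < d i \<Longrightarrow>
      concat_mat n s A $$ (p, (\<Sum>k<i. d k) + j) = A i $$ (p, j)"
proof -
  let ?L = "concat (map (\<lambda>i. cols (A i)) [0..<n])"
  have len: "length (cols (A i)) = d i" if "i < n" for i using A[OF that] by simp
  have L: "length ?L = total_dim n d"
    unfolding length_concat_blocks total_dim_def using len by (intro sum.cong) auto
  then show "concat_mat n s A \<in> carrier_mat s (total_dim n d)"
    unfolding concat_mat_def using mat_of_cols_carrier(1)[of s ?L] by simp
  fix p i j assume p: "p < s" and i: "i < n" and j: "j < d i"
  \<comment> \<open>Positions in the concatenated list are counted by list lengths; they agree with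
    the block offsets since every \<open>k < i\<close> is below \<open>n\<close>.\<close>
  have off: "(\<Sum>k<i. length (cols (A k))) = (\<Sum>k<i. d k)"
    using len i by (intro sum.cong) auto
  have "?L ! ((\<Sum>k<i. d k) + j) = cols (A i) ! j"
    using nth_concat_blocks[of i n j "\<lambda>i. cols (A i)"] i j len[OF i] off by simp
  then show "concat_mat n s A $$ (p, (\<Sum>k<i. d k) + j) = A i $$ (p, j)"
    unfolding concat_mat_def
    using p j A[OF i] block_index_less[of i n j d, OF i j] L by (simp add: mat_of_cols_index)
qed

text \<open>Grouping the flat sum over columns by blocks identifies each coordinate. The convergence
  analysis can then work with one matrix and no blocks.\<close>

lemma block_mult_eq_concat_mat:
  assumes A: "\<And>i. i < n \<Longrightarrow> A i \<in> carrier_mat s (d i)"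
    and x: "x \<in> carrier_vec (total_dim n d)"
  shows "block_mult n s d A x = concat_mat n s A *\<^sub>v x"
proof -
  note B = concat_mat_carrier[of n A s d, OF A]
  have Ab: "A i *\<^sub>v block d i x \<in> carrier_vec s" if "i < n" for i
    by (rule mult_mat_vec_carrier[OF A[OF that]]) simp
  have c: "block_mult n s d A x \<in> carrier_vec s"
    unfolding block_mult_def using Ab by (intro finsum_vec_closed) auto
  show ?thesis
  proof (rule eq_vecI)
    fix p assume "p < dim_vec (concat_mat n s A *\<^sub>v x)"
    then have p: "p < s" using B by simp
    have "(concat_mat n s A *\<^sub>v x) $ p = (\<Sum>k<total_dim n d. concat_mat n s A $$ (p, k) * x $ k)"
      using p B x by (simp add: scalar_prod_def lessThan_atLeast0)
    also have "\<dots> = (\<Sum>i<n. \<Sum>j<d i. A i $$ (p, j) * block d i x $ j)"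
      unfolding total_dim_def sum_lessThan_blocks
      using concat_mat_index[of n A s d, OF A p] by (simp add: block_index)
    also have "\<dots> = (\<Sum>i<n. (A i *\<^sub>v block d i x) $ p)"
    proof (rule sum.cong[OF refl])
      fix i assume "i \<in> {..<n}"
      then show "(\<Sum>j<d i. A i $$ (p, j) * block d i x $ j) = (A i *\<^sub>v block d i x) $ p"
        using p A[of i] by (simp add: scalar_prod_def lessThan_atLeast0)
    qed
    also have "\<dots> = block_mult n s d A x $ p"
      unfolding block_mult_def using Ab p by (subst index_finsum_vec) auto
    finally show "block_mult n s d A x $ p = (concat_mat n s A *\<^sub>v x) $ p" ..
  qed (use c B in simp)
qed

lemma block_transpose_concat_mat:
  assumes A: "\<And>i. i < n \<Longrightarrow> A i \<in> carrier_mat s (d i)"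
    and y: "y \<in> carrier_vec s" and i: "i < n"
  shows "block d i (transpose_mat (concat_mat n s A) *\<^sub>v y) = transpose_mat (A i) *\<^sub>v y"
proof (rule eq_vecI)
  note B = concat_mat_carrier[of n A s d, OF A]
  fix j assume "j < dim_vec (transpose_mat (A i) *\<^sub>v y)"
  then have j: "j < d i" using A[OF i] by simp
  show "block d i (transpose_mat (concat_mat n s A) *\<^sub>v y) $ j = (transpose_mat (A i) *\<^sub>v y) $ j"
    using B A[OF i] y j block_index_less[of i n j d, OF i j] concat_mat_index[of n A s d, OF A _ i j]
    by (simp add: block_index scalar_prod_def)
qed (use A[OF i] in simp)

text \<open>Perturbing only the \<open>i\<close>-th block of \<open>x\<close> isolates the summand \<open>r i\<close>, so differentiability
  of the sum implies differentiability of every summand.\<close>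

lemma has_gradient_block:
  assumes G: "has_gradient (total_dim n d) (separable_sum n d r) G x"
    and x: "x \<in> carrier_vec (total_dim n d)" and i: "i < n"
  shows "has_gradient (d i) (r i) (block d i G) (block d i x)"
  unfolding has_gradient_def
proof (intro conjI allI impI block_carrier)
  let ?o = "\<lambda>i. \<Sum>k<i. d k"
  have Gc: "G \<in> carrier_vec (total_dim n d)" using G by (simp add: has_gradient_def)
  fix \<epsilon> :: real assume "\<epsilon> > 0"
  then obtain \<delta> where \<delta>: "\<delta> > 0" and le: "\<And>v. v \<in> carrier_vec (total_dim n d) \<Longrightarrow>
      vnorm (v - x) < \<delta> \<Longrightarrow>
      \<bar>separable_sum n d r v - separable_sum n d r x - G \<bullet> (v - x)\<bar> \<le> \<epsilon> * vnorm (v - x)"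
    using G unfolding has_gradient_def by meson
  have "\<bar>r i w - r i (block d i x) - block d i G \<bullet> (w - block d i x)\<bar> \<le> \<epsilon> * vnorm (w - block d i x)"
    if w: "w \<in> carrier_vec (d i)" and small: "vnorm (w - block d i x) < \<delta>" for w
  proof -
    \<comment> \<open>The vector \<open>x\<close> with its block \<open>i\<close> replaced by
      \<open>w\<close>.\<close>
    define v where "v = vec (total_dim n d)
      (\<lambda>k. if ?o i \<le> k \<and> k < ?o i + d i then w $ (k - ?o i) else x $ k)"
    have v: "v \<in> carrier_vec (total_dim n d)" by (simp add: v_def)
    have vi: "block d i v = w"
      using w block_index_less[OF i] by (intro eq_vecI) (auto simp: block_index v_def)
    have vj: "block d j v = block d j x" if j: "j < n" "j \<noteq> i" for j
    proof (rule eq_vecI)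
      fix p assume "p < dim_vec (block d j x)"
      then have p: "p < d j" by simp
      \<comment> \<open>Blocks are disjoint index intervals: the earlier of the two ends no later
        than the other begins.\<close>
      have "\<not> (?o i \<le> ?o j + p \<and> ?o j + p < ?o i + d i)"
        using block_end_le[of i j d] block_end_le[of j i d] j(2) p by (cases "i < j") auto
      then show "block d j v $ p = block d j x $ p"
        using p block_index_less[of j n p d, OF j(1) p] by (auto simp: block_index v_def)
    qed simp
    have vx: "v - x \<in> carrier_vec (total_dim n d)" using v x by simp
    have bl: "block d j (v - x) = (if j = i then w - block d i x else 0\<^sub>v (d j))" if "j < n" for j
      using block_minus[OF v x that] vi vj[OF that] by simp
    \<comment> \<open>The perturbation is supported in block \<open>i\<close>. Taking
      \<open>u = v - x\<close> matches the norms, and \<open>u = G\<close> matches the gradient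
      terms.\<close>
    have prod: "u \<bullet> (v - x) = block d i u \<bullet> (w - block d i x)"
      if u: "u \<in> carrier_vec (total_dim n d)" for u
    proof -
      have "u \<bullet> (v - x) = (\<Sum>j<n. if j = i then block d i u \<bullet> (w - block d i x) else 0)"
        unfolding scalar_prod_blocks[OF u vx] using bl by (intro sum.cong) auto
      then show ?thesis using i by simp
    qed
    have "(vnorm (v - x))\<^sup>2 = (vnorm (w - block d i x))\<^sup>2"
      using prod[OF vx] bl[OF i] by (simp add: vnorm_sq)
    then have norm: "vnorm (v - x) = vnorm (w - block d i x)"
      by (simp add: power2_eq_iff_nonneg)
    have "separable_sum n d r v - separable_sum n d r x =
        (\<Sum>j<n. if j = i then r i w - r i (block d i x) else 0)"
      unfolding separable_sum_def sum_subtractf[symmetric] using vi vj by (intro sum.cong) auto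
    then have "separable_sum n d r v - separable_sum n d r x = r i w - r i (block d i x)"
      using i by simp
    then show ?thesis using le[OF v] small prod[OF Gc] norm by simp
  qed
  then show "\<exists>\<delta>>0. \<forall>w\<in>carrier_vec (d i). vnorm (w - block d i x) < \<delta> \<longrightarrow>
      \<bar>r i w - r i (block d i x) - block d i G \<bullet> (w - block d i x)\<bar> \<le> \<epsilon> * vnorm (w - block d i x)"
    using \<delta> by blast
qed

text \<open>Uniqueness of gradients carries the preceding result over to \<open>gradient\<close>, so
  the algorithm's blockwise gradients can be read off from the gradient of the sum.\<close>

lemma gradient_block:
  assumes "L_smooth (total_dim n d) L (separable_sum n d r)"
    and "x \<in> carrier_vec (total_dim n d)" and "i < n"
  shows "gradient (d i) (r i) (block d i x) =
    block d i (gradient (total_dim n d) (separable_sum n d r) x)"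
  using has_gradient_block[OF L_smooth_has_gradient[OF assms(1,2)] assms(2,3)]
  by (rule gradient_eqI) simp

section \<open>The extragradient step\<close>

text \<open>After substituting \<open>h\<close> and \<open>a'\<close> this is a polynomial identity
  in each coordinate: the squares of \<open>\<gamma> * p $ i\<close> and
  \<open>\<gamma> * q $ i\<close> cancel. Here \<open>p\<close> stands for the operator at the
  current point and \<open>q\<close> for the operator at the half step.\<close>

lemma extragradient_identity:
  fixes a u p q :: "real vec"
  assumes "a \<in> carrier_vec m" "u \<in> carrier_vec m" "p \<in> carrier_vec m" "q \<in> carrier_vec m"
    and h: "h = a - \<gamma> \<cdot>\<^sub>v p" and a': "a' = a - \<gamma> \<cdot>\<^sub>v q"
  shows "2 * \<gamma> * (q \<bullet> (h - u)) =
    (vnorm (a - u))\<^sup>2 - (vnorm (a' - u))\<^sup>2 + \<gamma>\<^sup>2 * (vnorm (q - p))\<^sup>2 - (vnorm (h - a))\<^sup>2"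
proof -
  have dims: "dim_vec a = m" "dim_vec u = m" "dim_vec p = m" "dim_vec q = m"
    using assms by auto
  have "2 * \<gamma> * (q \<bullet> (h - u)) =
      (\<Sum>i\<in>{0..<m}. 2 * \<gamma> * (q $ i * (a $ i - \<gamma> * p $ i - u $ i)))"
    by (simp add: scalar_prod_def h dims sum_distrib_left)
  also have "\<dots> = (\<Sum>i\<in>{0..<m}. (a $ i - u $ i) * (a $ i - u $ i)
      - (a $ i - \<gamma> * q $ i - u $ i) * (a $ i - \<gamma> * q $ i - u $ i)
      + \<gamma>\<^sup>2 * ((q $ i - p $ i) * (q $ i - p $ i))
      - (a $ i - \<gamma> * p $ i - a $ i) * (a $ i - \<gamma> * p $ i - a $ i))"
    by (rule sum.cong[OF refl]) (simp add: power2_eq_square algebra_simps)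
  also have "\<dots> = (vnorm (a - u))\<^sup>2 - (vnorm (a' - u))\<^sup>2 + \<gamma>\<^sup>2 * (vnorm (q - p))\<^sup>2
      - (vnorm (h - a))\<^sup>2"
    unfolding sum_subtractf sum.distrib sum_distrib_left[symmetric]
    by (simp add: vnorm_sq scalar_prod_def h a' dims)
  finally show ?thesis .
qed

lemma vec_add_diff_add:
  fixes a b c d :: "'a::ab_group_add vec"
  assumes "a \<in> carrier_vec m" "b \<in> carrier_vec m" "c \<in> carrier_vec m" "d \<in> carrier_vec m"
  shows "(a + b) - (c + d) = (a - c) + (b - d)"
  using assms by (intro eq_vecI) auto

lemma vec_diff_diff_diff:
  fixes a b c d :: "'a::ab_group_add vec"
  assumes "a \<in> carrier_vec m" "b \<in> carrier_vec m" "c \<in> carrier_vec m" "d \<in> carrier_vec m"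
  shows "(a - b) - (c - d) = (d - b) + (a - c)"
  using assms by (intro eq_vecI) auto

text \<open>Both squared stepsize products are at most 1/4, and the factors 2 come from
  \<open>vnorm_add_sq_le\<close>. Applied to both components, the bound totals \<open>X + Y\<close>,
  which is what the extragradient identities subtract.\<close>

lemma half_step_bound:
  fixes \<gamma> a b X Y :: real
  assumes "0 \<le> \<gamma>" "0 \<le> a" "0 \<le> b" "\<gamma> * sqrt a \<le> 1/2" "\<gamma> * b \<le> 1/2" "0 \<le> X" "0 \<le> Y"
  shows "\<gamma>\<^sup>2 * (2 * (a * X) + 2 * (b\<^sup>2 * Y)) \<le> X / 2 + Y / 2"
proof -
  have "(\<gamma> * sqrt a)\<^sup>2 \<le> (1/2)\<^sup>2" "(\<gamma> * b)\<^sup>2 \<le> (1/2)\<^sup>2"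
    using assms by (intro power_mono; simp)+
  then have "\<gamma>\<^sup>2 * a \<le> 1/4" "\<gamma>\<^sup>2 * b\<^sup>2 \<le> 1/4"
    using assms by (simp_all add: power_mult_distrib power_divide)
  then have "\<gamma>\<^sup>2 * a * X \<le> 1/4 * X" "\<gamma>\<^sup>2 * b\<^sup>2 * Y \<le> 1/4 * Y"
    using assms by (intro mult_right_mono; simp)+
  then show ?thesis by (simp add: algebra_simps)
qed

text \<open>The tangent inequalities handle \<open>f\<close> and \<open>g\<close>. The bilinear part
  is exact: the skew coupling makes the two occurrences of
  \<open>c \<bullet> (B *\<^sub>v a)\<close> cancel.\<close>

lemma bilinear_saddle_gap_le:
  fixes B :: "real mat"
  assumes B: "B \<in> carrier_mat s m"
    and f: "vconvex m f" "has_gradient m f p a" and g: "vconvex s g" "has_gradient s g q c"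
    and [simp]: "a \<in> carrier_vec m" "u \<in> carrier_vec m" "c \<in> carrier_vec s" "v \<in> carrier_vec s"
  shows "(- g v + f a + v \<bullet> (B *\<^sub>v a)) - (- g c + f u + c \<bullet> (B *\<^sub>v u)) \<le>
    (transpose_mat B *\<^sub>v c + p) \<bullet> (a - u) + (q - B *\<^sub>v a) \<bullet> (c - v)"
proof -
  have [simp]: "p \<in> carrier_vec m" "q \<in> carrier_vec s"
    using f g by (auto simp: has_gradient_def)
  have [simp]: "transpose_mat B *\<^sub>v c \<in> carrier_vec m" "B *\<^sub>v a \<in> carrier_vec s"
    by (rule mult_mat_vec_carrier[of _ _ s] mult_mat_vec_carrier[of _ _ m];
        use B in simp)+
  have "f a - f u \<le> p \<bullet> (a - u)"
    using vconvex_gradient_le[OF f, of u] by (simp add: scalar_prod_minus_distrib[of _ m])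
  moreover have "g c - g v \<le> q \<bullet> (c - v)"
    using vconvex_gradient_le[OF g, of v] by (simp add: scalar_prod_minus_distrib[of _ s])
  moreover have "(transpose_mat B *\<^sub>v c + p) \<bullet> (a - u) =
      c \<bullet> (B *\<^sub>v a) - c \<bullet> (B *\<^sub>v u) + p \<bullet> (a - u)"
    by (simp add: add_scalar_prod_distrib[of _ m] scalar_prod_minus_distrib[of _ m]
        transpose_vec_mult_scalar[OF B])
  moreover have "(q - B *\<^sub>v a) \<bullet> (c - v) =
      q \<bullet> (c - v) - (c \<bullet> (B *\<^sub>v a) - v \<bullet> (B *\<^sub>v a))"
    by (simp add: minus_scalar_prod_distrib[of _ s] scalar_prod_minus_distrib[of _ s]
        comm_scalar_prod[of "B *\<^sub>v a" s])
  ultimately show ?thesis by simp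
qed

lemma extragradient_step:
  fixes B :: "real mat"
  assumes B: "B \<in> carrier_mat s m" and m: "m > 0"
    and lam: "lam = lambda_max (transpose_mat B * B)"
    and f: "L_smooth m Lr f" "vconvex m f" and g: "L_smooth s Ll g" "vconvex s g"
    and \<gamma>: "\<gamma> > 0" "\<gamma> * sqrt lam \<le> 1/2" "\<gamma> * Lr \<le> 1/2" "\<gamma> * Ll \<le> 1/2"
    and a: "a \<in> carrier_vec m" and c: "c \<in> carrier_vec s"
    and u: "u \<in> carrier_vec m" and v: "v \<in> carrier_vec s"
    and ah: "ah = a - \<gamma> \<cdot>\<^sub>v (transpose_mat B *\<^sub>v c + gradient m f a)"
    and ch: "ch = c - \<gamma> \<cdot>\<^sub>v (gradient s g c - B *\<^sub>v a)"
    and a': "a' = a - \<gamma> \<cdot>\<^sub>v (transpose_mat B *\<^sub>v ch + gradient m f ah)"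
    and c': "c' = c - \<gamma> \<cdot>\<^sub>v (gradient s g ch - B *\<^sub>v ah)"
  shows "2 * \<gamma> * ((- g v + f ah + v \<bullet> (B *\<^sub>v ah)) - (- g ch + f u + ch \<bullet> (B *\<^sub>v u))) \<le>
    ((vnorm (a - u))\<^sup>2 + (vnorm (c - v))\<^sup>2) - ((vnorm (a' - u))\<^sup>2 + (vnorm (c' - v))\<^sup>2)"
proof -
  have BT: "transpose_mat B \<in> carrier_mat m s" using B by simp
  note cB = mult_mat_vec_carrier[OF B] and cBT = mult_mat_vec_carrier[OF BT]
  have p: "transpose_mat B *\<^sub>v c + gradient m f a \<in> carrier_vec m"
    using cBT[OF c] gradient_carrier[OF f(1) a] by simp
  have q: "gradient s g c - B *\<^sub>v a \<in> carrier_vec s"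
    using cB[OF a] gradient_carrier[OF g(1) c] by simp
  have ahc: "ah \<in> carrier_vec m" unfolding ah using a p by simp
  have chc: "ch \<in> carrier_vec s" unfolding ch using c q by simp
  have p': "transpose_mat B *\<^sub>v ch + gradient m f ah \<in> carrier_vec m"
    using cBT[OF chc] gradient_carrier[OF f(1) ahc] by simp
  have q': "gradient s g ch - B *\<^sub>v ah \<in> carrier_vec s"
    using cB[OF ahc] gradient_carrier[OF g(1) chc] by simp
  have lam0: "0 \<le> lam" unfolding lam by (rule lambda_max_gram_nonneg[OF B m])
  have Lr: "0 < Lr" and Ll: "0 < Ll" using f g by (auto simp: L_smooth_def)
  define dx where "dx = (vnorm (ah - a))\<^sup>2"
  define dy where "dy = (vnorm (ch - c))\<^sup>2"
  have da: "ah - a \<in> carrier_vec m" and dc: "ch - c \<in> carrier_vec s"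
    using ahc a chc c by simp_all
  have grad_f: "(vnorm (gradient m f ah - gradient m f a))\<^sup>2 \<le> Lr\<^sup>2 * dx"
    using f(1) ahc a unfolding L_smooth_def dx_def power_mult_distrib[symmetric]
    by (intro power_mono) auto
  have grad_g: "(vnorm (gradient s g ch - gradient s g c))\<^sup>2 \<le> Ll\<^sup>2 * dy"
    using g(1) chc c unfolding L_smooth_def dy_def power_mult_distrib[symmetric]
    by (intro power_mono) auto
  \<comment> \<open>In the first operator component the coupling sees the displacement of
    \<open>c\<close> and the gradient that of \<open>a\<close>, hence the mixed bound in
    \<open>dy\<close> and \<open>dx\<close>.\<close>
  have "(transpose_mat B *\<^sub>v ch + gradient m f ah) - (transpose_mat B *\<^sub>v c + gradient m f a) =
      transpose_mat B *\<^sub>v (ch - c) + (gradient m f ah - gradient m f a)"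
    unfolding mult_minus_distrib_mat_vec[OF BT chc c]
    by (rule vec_add_diff_add[OF cBT[OF chc] gradient_carrier[OF f(1) ahc]
          cBT[OF c] gradient_carrier[OF f(1) a]])
  then have "(vnorm ((transpose_mat B *\<^sub>v ch + gradient m f ah) -
      (transpose_mat B *\<^sub>v c + gradient m f a)))\<^sup>2 \<le> 2 * (lam * dy) + 2 * (Lr\<^sup>2 * dx)"
    using vnorm_add_sq_le[OF cBT[OF dc], of "gradient m f ah - gradient m f a"] grad_f
      vnorm_mult_transpose_sq_le[OF B m dc] gradient_carrier[OF f(1) ahc] gradient_carrier[OF f(1) a]
    by (simp add: lam dy_def)
  then have x_le: "\<gamma>\<^sup>2 * (vnorm ((transpose_mat B *\<^sub>v ch + gradient m f ah) -
      (transpose_mat B *\<^sub>v c + gradient m f a)))\<^sup>2 \<le> \<gamma>\<^sup>2 * (2 * (lam * dy) + 2 * (Lr\<^sup>2 * dx))"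
    by (intro mult_left_mono) auto
  \<comment> \<open>The roles are exchanged in the second component. The minus sign reverses the
    displacement to \<open>a - ah\<close>, which does not change its norm.\<close>
  have "(gradient s g ch - B *\<^sub>v ah) - (gradient s g c - B *\<^sub>v a) =
      B *\<^sub>v (a - ah) + (gradient s g ch - gradient s g c)"
    unfolding mult_minus_distrib_mat_vec[OF B a ahc]
    by (rule vec_diff_diff_diff[OF gradient_carrier[OF g(1) chc] cB[OF ahc]
          gradient_carrier[OF g(1) c] cB[OF a]])
  moreover have "a - ah \<in> carrier_vec m" using a ahc by simp
  ultimately have "(vnorm ((gradient s g ch - B *\<^sub>v ah) - (gradient s g c - B *\<^sub>v a)))\<^sup>2 \<le>
      2 * (lam * dx) + 2 * (Ll\<^sup>2 * dy)"
    using vnorm_add_sq_le[OF cB, of "a - ah" "gradient s g ch - gradient s g c"] grad_g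
      vnorm_mult_mat_vec_sq_le[OF B m, of "a - ah"] gradient_carrier[OF g(1) chc]
      gradient_carrier[OF g(1) c] vnorm_minus_commute[OF a ahc]
    by (simp add: lam dx_def)
  then have y_le: "\<gamma>\<^sup>2 * (vnorm ((gradient s g ch - B *\<^sub>v ah) - (gradient s g c - B *\<^sub>v a)))\<^sup>2 \<le>
      \<gamma>\<^sup>2 * (2 * (lam * dx) + 2 * (Ll\<^sup>2 * dy))"
    by (intro mult_left_mono) auto
  have "0 \<le> dx" "0 \<le> dy" by (simp_all add: dx_def dy_def)
  then have small: "\<gamma>\<^sup>2 * (2 * (lam * dy) + 2 * (Lr\<^sup>2 * dx)) \<le> dy / 2 + dx / 2"
      "\<gamma>\<^sup>2 * (2 * (lam * dx) + 2 * (Ll\<^sup>2 * dy)) \<le> dx / 2 + dy / 2"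
    using half_step_bound[of \<gamma> lam Lr dy dx] half_step_bound[of \<gamma> lam Ll dx dy] \<gamma> lam0 Lr Ll
    by simp_all
  \<comment> \<open>Adding the two identities: by \<open>small\<close> the operator differences
    contribute at most \<open>dx + dy\<close>, and exactly this amount is subtracted.\<close>
  have "2 * \<gamma> * ((transpose_mat B *\<^sub>v ch + gradient m f ah) \<bullet> (ah - u)) +
      2 * \<gamma> * ((gradient s g ch - B *\<^sub>v ah) \<bullet> (ch - v)) \<le>
      ((vnorm (a - u))\<^sup>2 + (vnorm (c - v))\<^sup>2) - ((vnorm (a' - u))\<^sup>2 + (vnorm (c' - v))\<^sup>2)"
    using extragradient_identity[OF a u p p' ah a'] extragradient_identity[OF c v q q' ch c']
      x_le y_le small by (simp only: dx_def[symmetric] dy_def[symmetric])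
  moreover have "2 * \<gamma> * ((- g v + f ah + v \<bullet> (B *\<^sub>v ah)) - (- g ch + f u + ch \<bullet> (B *\<^sub>v u))) \<le>
      2 * \<gamma> * ((transpose_mat B *\<^sub>v ch + gradient m f ah) \<bullet> (ah - u) +
        (gradient s g ch - B *\<^sub>v ah) \<bullet> (ch - v))"
    using \<gamma>(1) by (intro mult_left_mono bilinear_saddle_gap_le[OF B f(2)
        L_smooth_has_gradient[OF f(1) ahc] g(2) L_smooth_has_gradient[OF g(1) chc] ahc u chc v]) simp
  ultimately show ?thesis by (simp only: distrib_left)
qed

section \<open>Telescoping and averaging over the iterations\<close>

lemma extragradient_average_gap_le:
  fixes B :: "real mat"
  assumes B: "B \<in> carrier_mat s m" and m: "m > 0"
    and lam: "lam = lambda_max (transpose_mat B * B)"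
    and f: "L_smooth m Lr f" "vconvex m f" and g: "L_smooth s Ll g" "vconvex s g"
    and \<gamma>: "\<gamma> > 0" "\<gamma> * sqrt lam \<le> 1/2" "\<gamma> * Lr \<le> 1/2" "\<gamma> * Ll \<le> 1/2"
    and K: "K > 0"
    and xc: "\<And>k. k \<le> K \<Longrightarrow> x k \<in> carrier_vec m" and yc: "\<And>k. k \<le> K \<Longrightarrow> y k \<in> carrier_vec s"
    and xhc: "\<And>k. k < K \<Longrightarrow> xh k \<in> carrier_vec m" and yhc: "\<And>k. k < K \<Longrightarrow> yh k \<in> carrier_vec s"
    and xh: "\<And>k. k < K \<Longrightarrow> xh k = x k - \<gamma> \<cdot>\<^sub>v (transpose_mat B *\<^sub>v y k + gradient m f (x k))"
    and yh: "\<And>k. k < K \<Longrightarrow> yh k = y k - \<gamma> \<cdot>\<^sub>v (gradient s g (y k) - B *\<^sub>v x k)"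
    and x': "\<And>k. k < K \<Longrightarrow> x (Suc k) =
      x k - \<gamma> \<cdot>\<^sub>v (transpose_mat B *\<^sub>v yh k + gradient m f (xh k))"
    and y': "\<And>k. k < K \<Longrightarrow> y (Suc k) = y k - \<gamma> \<cdot>\<^sub>v (gradient s g (yh k) - B *\<^sub>v xh k)"
    and u: "u \<in> carrier_vec m" and v: "v \<in> carrier_vec s"
  shows "(- g v + f (vec_average m K xh) + v \<bullet> (B *\<^sub>v vec_average m K xh)) -
      (- g (vec_average s K yh) + f u + vec_average s K yh \<bullet> (B *\<^sub>v u))
    \<le> ((vnorm (x 0 - u))\<^sup>2 + (vnorm (y 0 - v))\<^sup>2) / (2 * \<gamma>) / real K"
proof -
  define D where "D = (\<lambda>k. (vnorm (x k - u))\<^sup>2 + (vnorm (y k - v))\<^sup>2)"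
  define G where "G = (\<lambda>k. (- g v + f (xh k) + v \<bullet> (B *\<^sub>v xh k)) -
    (- g (yh k) + f u + yh k \<bullet> (B *\<^sub>v u)))"
  define xa where "xa = vec_average m K xh"
  define ya where "ya = vec_average s K yh"
  have xac: "xa \<in> carrier_vec m" and yac: "ya \<in> carrier_vec s"
    using xhc yhc by (simp_all add: xa_def ya_def)
  have BT: "transpose_mat B \<in> carrier_mat m s" using B by simp
  note cB = mult_mat_vec_carrier[OF B] and cBT = mult_mat_vec_carrier[OF BT]
  have "(\<Sum>k<K. 2 * \<gamma> * G k) \<le> (\<Sum>k<K. D k - D (Suc k))"
  proof (rule sum_mono)
    fix k assume "k \<in> {..<K}"
    then have k: "k < K" by simp
    show "2 * \<gamma> * G k \<le> D k - D (Suc k)"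
      unfolding G_def D_def using k
      by (intro extragradient_step[OF B m lam f g \<gamma> xc yc u v xh yh x' y']) simp_all
  qed
  also have "\<dots> = D 0 - D K"
    by (rule sum_lessThan_telescope')
  also have "\<dots> \<le> D 0" by (simp add: D_def)
  finally have "2 * \<gamma> * (\<Sum>k<K. G k) \<le> D 0" by (simp add: sum_distrib_left)
  then have sum_G: "(\<Sum>k<K. G k) \<le> D 0 / (2 * \<gamma>)"
    using \<gamma>(1) by (simp add: pos_le_divide_eq mult.commute)
  \<comment> \<open>The gap is convex in the half-step pair: subtracting the comparison value turns
    \<open>- g\<close> into \<open>g\<close>, so Jensen's inequality acts in the right direction for
    both functions.\<close>
  have fa: "f xa \<le> (\<Sum>k<K. f (xh k)) / real K"
    unfolding xa_def by (rule vconvex_vec_average_le[OF f(2,1) K xhc])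
  have ga: "g ya \<le> (\<Sum>k<K. g (yh k)) / real K"
    unfolding ya_def by (rule vconvex_vec_average_le[OF g(2,1) K yhc])
  \<comment> \<open>Moving \<open>B\<close> to the fixed vector exhibits a linear functional of the
    average.\<close>
  have "v \<bullet> (B *\<^sub>v xa) = (transpose_mat B *\<^sub>v v) \<bullet> xa"
    by (rule transpose_vec_mult_scalar[OF B xac v, symmetric])
  also have "\<dots> = (\<Sum>k<K. (transpose_mat B *\<^sub>v v) \<bullet> xh k) / real K"
    unfolding xa_def by (rule scalar_prod_vec_average[OF cBT[OF v] xhc])
  also have "\<dots> = (\<Sum>k<K. v \<bullet> (B *\<^sub>v xh k)) / real K"
    using transpose_vec_mult_scalar[OF B xhc v] by simp
  finally have va: "v \<bullet> (B *\<^sub>v xa) = (\<Sum>k<K. v \<bullet> (B *\<^sub>v xh k)) / real K" .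
  have "ya \<bullet> (B *\<^sub>v u) = (B *\<^sub>v u) \<bullet> ya"
    by (rule comm_scalar_prod[OF yac cB[OF u]])
  also have "\<dots> = (\<Sum>k<K. (B *\<^sub>v u) \<bullet> yh k) / real K"
    unfolding ya_def by (rule scalar_prod_vec_average[OF cB[OF u] yhc])
  also have "\<dots> = (\<Sum>k<K. yh k \<bullet> (B *\<^sub>v u)) / real K"
    using comm_scalar_prod[OF cB[OF u] yhc] by simp
  finally have ua: "ya \<bullet> (B *\<^sub>v u) = (\<Sum>k<K. yh k \<bullet> (B *\<^sub>v u)) / real K" .
  have "(\<Sum>k<K. G k) = (\<Sum>k<K. f (xh k)) + (\<Sum>k<K. v \<bullet> (B *\<^sub>v xh k)) + (\<Sum>k<K. g (yh k))
      - (\<Sum>k<K. yh k \<bullet> (B *\<^sub>v u)) - real K * (g v + f u)"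
    by (simp add: G_def sum.distrib sum_subtractf sum_negf algebra_simps)
  then have "(\<Sum>k<K. G k) / real K = (\<Sum>k<K. f (xh k)) / real K + v \<bullet> (B *\<^sub>v xa)
      + (\<Sum>k<K. g (yh k)) / real K - ya \<bullet> (B *\<^sub>v u) - (g v + f u)"
    using K by (simp add: va ua add_divide_distrib diff_divide_distrib)
  moreover have "(\<Sum>k<K. G k) / real K \<le> D 0 / (2 * \<gamma>) / real K"
    using sum_G by (intro divide_right_mono) auto
  ultimately show ?thesis
    using fa ga unfolding D_def xa_def ya_def by linarith
qed

section \<open>Stepsize, compact sets and the gap criterion\<close>

lemma stepsize_bounds:
  assumes lam: "0 \<le> lam" and Lr: "0 < Lr" and Ll: "0 < Ll"
  defines "\<gamma> \<equiv> stepsize lam Lr Ll"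
  shows "0 < \<gamma>" "\<gamma> * sqrt lam \<le> 1/2" "\<gamma> * Lr \<le> 1/2" "\<gamma> * Ll \<le> 1/2"
    and "1 / (2 * \<gamma>) \<le> 1 + sqrt lam + Ll + Lr"
proof -
  define M where "M = Min {1, 1 / ereal (sqrt lam), 1 / ereal Lr, 1 / ereal Ll}"
  have "M \<in> {1, 1 / ereal (sqrt lam), 1 / ereal Lr, 1 / ereal Ll}"
    unfolding M_def by (intro Min_in) auto
  then have cases: "M = 1 \<or> M = 1 / ereal (sqrt lam) \<or> M = 1 / ereal Lr \<or> M = 1 / ereal Ll"
    by simp
  have le: "M \<le> 1" "M \<le> 1 / ereal (sqrt lam)" "M \<le> 1 / ereal Lr" "M \<le> 1 / ereal Ll"
    unfolding M_def by (rule Min_le; simp)+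
  have "1 / ereal (sqrt lam) = \<infinity>" if "lam = 0" using that by simp
  moreover have sq: "1 / ereal (sqrt lam) = ereal (1 / sqrt lam)" if "lam \<noteq> 0"
    using that by (simp add: one_ereal_def)
  moreover have r: "1 / ereal Lr = ereal (1 / Lr)" "1 / ereal Ll = ereal (1 / Ll)"
    using Lr Ll by (simp_all add: one_ereal_def)
  \<comment> \<open>For \<open>lam = 0\<close> the corresponding entry is infinite and
    \<open>M \<le> 1\<close> excludes it; hence the minimum is a real number and
    \<open>real_of_ereal\<close> loses nothing.\<close>
  ultimately obtain \<mu> where \<mu>: "M = ereal \<mu>" "\<mu> = 1 \<or> lam \<noteq> 0 \<and> \<mu> = 1 / sqrt lam \<or> \<mu> = 1 / Lr \<or> \<mu> = 1 / Ll"
    using cases le(1) by (cases "lam = 0") (auto simp: one_ereal_def)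
  have \<gamma>: "\<gamma> = \<mu> / 2" by (simp add: \<gamma>_def stepsize_def \<mu>(1) flip: M_def)
  have s0: "0 \<le> sqrt lam" using lam by simp
  have pos: "0 < \<mu>" using \<mu>(2) lam Lr Ll by auto
  have "\<mu> * sqrt lam \<le> 1"
  proof (cases "lam = 0")
    case False
    then have "\<mu> \<le> 1 / sqrt lam" "0 < sqrt lam" using le(2) sq \<mu>(1) lam by auto
    then show ?thesis by (simp add: pos_le_divide_eq)
  qed simp
  moreover have "\<mu> * Lr \<le> 1" "\<mu> * Ll \<le> 1"
    using le(3,4) r \<mu>(1) Lr Ll by (simp_all add: pos_le_divide_eq)
  ultimately show "0 < \<gamma>" "\<gamma> * sqrt lam \<le> 1/2" "\<gamma> * Lr \<le> 1/2" "\<gamma> * Ll \<le> 1/2"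
    using pos by (simp_all add: \<gamma>)
  \<comment> \<open>The reciprocal is one of four nonnegative numbers, hence at most their sum; this
    produces the constant of the rate.\<close>
  have "1 / \<mu> = 1 \<or> 1 / \<mu> = sqrt lam \<or> 1 / \<mu> = Lr \<or> 1 / \<mu> = Ll"
    using \<mu>(2) by auto
  then show "1 / (2 * \<gamma>) \<le> 1 + sqrt lam + Ll + Lr"
    using s0 Lr Ll by (auto simp: \<gamma>)
qed

text \<open>Coordinate projections are continuous on the Euclidean space, so the image of a compact
  set is compact in the reals and therefore bounded.\<close>

lemma vcompact_coordinate_bounded:
  assumes S: "vcompact m S" and i: "i < m"
  shows "\<exists>b. \<forall>z\<in>S. \<bar>z $ i\<bar> \<le> b"
proof -
  have "continuous_map (Euclidean_space m) euclideanreal (\<lambda>f. f i)"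
    unfolding Euclidean_space_def
    by (intro continuous_map_from_subtopology continuous_map_product_projection) simp
  then have "compactin euclideanreal
      ((\<lambda>f. f i) ` (\<lambda>v j. if j < m then v $ j else 0) ` S)"
    using S image_compactin unfolding vcompact_def by blast
  then have "bounded ((\<lambda>f. f i) ` (\<lambda>v j. if j < m then v $ j else 0) ` S)"
    by (simp add: compact_imp_bounded)
  then show ?thesis using i by (auto simp: bounded_iff)
qed

lemma vcompact_dist_bounded:
  assumes S: "vcompact m S" and x0: "x0 \<in> carrier_vec m"
  shows "\<exists>R. \<forall>z\<in>S. (vnorm (x0 - z))\<^sup>2 \<le> R"
proof -
  obtain b where b: "\<And>i z. i < m \<Longrightarrow> z \<in> S \<Longrightarrow> \<bar>z $ i\<bar> \<le> b i"
    using vcompact_coordinate_bounded[OF S] by metis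
  have "(vnorm (x0 - z))\<^sup>2 \<le> (\<Sum>i\<in>{0..<m}. (\<bar>x0 $ i\<bar> + b i)\<^sup>2)" if z: "z \<in> S" for z
  proof -
    have zc: "z \<in> carrier_vec m" using S z by (auto simp: vcompact_def)
    have "(vnorm (x0 - z))\<^sup>2 = (\<Sum>i\<in>{0..<m}. \<bar>x0 $ i - z $ i\<bar>\<^sup>2)"
      using x0 zc by (simp add: vnorm_sq scalar_prod_def flip: power2_eq_square)
    also have "\<dots> \<le> (\<Sum>i\<in>{0..<m}. (\<bar>x0 $ i\<bar> + b i)\<^sup>2)"
    proof (intro sum_mono power_mono abs_ge_zero)
      fix i assume "i \<in> {0..<m}"
      then show "\<bar>x0 $ i - z $ i\<bar> \<le> \<bar>x0 $ i\<bar> + b i" using b[of i z] z by auto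
    qed
    finally show ?thesis .
  qed
  then show ?thesis by blast
qed

text \<open>A real supremum dominates its members only when they are bounded above; compactness of
  both sets provides such a bound.\<close>

lemma sq_dist_le_sq_diameter:
  assumes X: "vcompact m X" "x0 \<in> carrier_vec m" and Y: "vcompact s Y" "y0 \<in> carrier_vec s"
    and u: "u \<in> X" and v: "v \<in> Y"
  shows "(vnorm (x0 - u))\<^sup>2 + (vnorm (y0 - v))\<^sup>2 \<le> sq_diameter X Y x0 y0"
proof -
  obtain Rx Ry where "\<And>z. z \<in> X \<Longrightarrow> (vnorm (x0 - z))\<^sup>2 \<le> Rx" "\<And>z. z \<in> Y \<Longrightarrow> (vnorm (y0 - z))\<^sup>2 \<le> Ry"
    using vcompact_dist_bounded[OF X] vcompact_dist_bounded[OF Y] by blast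
  then have "bdd_above ((\<lambda>(x, y). (vnorm (x0 - x))\<^sup>2 + (vnorm (y0 - y))\<^sup>2) ` (X \<times> Y))"
    by (intro bdd_aboveI[of _ "Rx + Ry"]) (auto intro: add_mono)
  then show ?thesis
    unfolding sq_diameter_def using cSUP_upper[of "(u, v)" "X \<times> Y"] u v by force
qed

text \<open>Nonemptiness turns pointwise bounds into bounds on the extrema: first the supremum over
  \<open>Y\<close> for fixed \<open>u\<close>, then the infimum over \<open>X\<close>.\<close>

lemma gap2_leI:
  assumes "X \<noteq> {}" "Y \<noteq> {}"
    and le: "\<And>u v. u \<in> X \<Longrightarrow> v \<in> Y \<Longrightarrow> L x v - L u y \<le> c"
  shows "gap2 L X Y x y \<le> c"
proof -
  have "(SUP v\<in>Y. L x v) - c \<le> L u y" if "u \<in> X" for u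
  proof -
    have "(SUP v\<in>Y. L x v) \<le> L u y + c"
      using le[OF that] by (intro cSUP_least[OF \<open>Y \<noteq> {}\<close>]) (simp add: algebra_simps)
    then show ?thesis by simp
  qed
  then have "(SUP v\<in>Y. L x v) - c \<le> (INF u\<in>X. L u y)"
    by (intro cINF_greatest[OF \<open>X \<noteq> {}\<close>])
  then show ?thesis by (simp add: gap2_def)
qed

section \<open>From blockwise updates to the vector iteration, and the final bound\<close>

lemma total_dim_pos:
  assumes "n > 0" "\<forall>i<n. d i > 0"
  shows "total_dim n d > 0"
  using block_index_less[of 0 n 0 d] assms by simp

text \<open>A vector is determined by its blocks, so the blockwise updates assemble into one. The
  gradient point \<open>z\<close> is separate from \<open>a\<close> to cover the half step, with
  \<open>z = a\<close>, and the full step, with \<open>z\<close> the half-step iterate.\<close>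

lemma block_update_eq:
  assumes A: "\<And>i. i < n \<Longrightarrow> A i \<in> carrier_mat s (d i)"
    and f: "L_smooth (total_dim n d) L (separable_sum n d r)"
    and a: "a \<in> carrier_vec (total_dim n d)" and z: "z \<in> carrier_vec (total_dim n d)"
    and a': "a' \<in> carrier_vec (total_dim n d)" and y: "y \<in> carrier_vec s"
    and upd: "\<And>i. i < n \<Longrightarrow> block d i a' = block d i a - \<gamma> \<cdot>\<^sub>v
      (transpose_mat (A i) *\<^sub>v y + gradient (d i) (r i) (block d i z))"
  shows "a' = a - \<gamma> \<cdot>\<^sub>v (transpose_mat (concat_mat n s A) *\<^sub>v y +
    gradient (total_dim n d) (separable_sum n d r) z)"
proof -
  let ?m = "total_dim n d"
  have BT: "transpose_mat (concat_mat n s A) *\<^sub>v y \<in> carrier_vec ?m"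
    using concat_mat_carrier[of n A s d, OF A] y
    by (intro mult_mat_vec_carrier[of _ ?m s]) simp_all
  note G = gradient_carrier[OF f z]
  show ?thesis
  proof (rule eq_vec_blocksI[OF a'])
    fix i assume i: "i < n"
    show "block d i a' = block d i (a - \<gamma> \<cdot>\<^sub>v (transpose_mat (concat_mat n s A) *\<^sub>v y +
        gradient ?m (separable_sum n d r) z))"
      using a BT G i
      by (simp add: upd block_minus[of _ n] block_smult[of _ n] block_add[of _ n]
          block_transpose_concat_mat[OF A y i] gradient_block[OF f z i])
  qed (use a BT G in simp)
qed

theorem theorem10:
  shows "\<exists>C::real. C > 0 \<and>
    (\<forall>(n::nat) (s::nat) (d::nat \<Rightarrow> nat) (A::nat \<Rightarrow> real mat) (b::real vec)
      (r::nat \<Rightarrow> real vec \<Rightarrow> real) (l::real vec \<Rightarrow> real vec \<Rightarrow> real)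
      (Lr::real) (Ll::real) (X::real vec set) (Y::real vec set) (\<gamma>::real) (lam::real)
      (x::nat \<Rightarrow> real vec) (xh::nat \<Rightarrow> real vec) (y::nat \<Rightarrow> real vec) (yh::nat \<Rightarrow> real vec) (K::nat).
      n > 0 \<longrightarrow> s > 0 \<longrightarrow> (\<forall>i<n. d i > 0) \<longrightarrow>
      (\<forall>i<n. A i \<in> carrier_mat s (d i)) \<longrightarrow>
      b \<in> carrier_vec s \<longrightarrow>
      dual_finite s l b \<longrightarrow>
      L_smooth s Ll (dual s l b) \<longrightarrow> vconvex s (dual s l b) \<longrightarrow>
      L_smooth (total_dim n d) Lr (separable_sum n d r) \<longrightarrow>
      vconvex (total_dim n d) (separable_sum n d r) \<longrightarrow>
      vcompact (total_dim n d) X \<longrightarrow> X \<noteq> {} \<longrightarrow>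
      vcompact s Y \<longrightarrow> Y \<noteq> {} \<longrightarrow>
      lam = lambda_max (transpose_mat (concat_mat n s A) * concat_mat n s A) \<longrightarrow>
      \<gamma> = stepsize lam Lr Ll \<longrightarrow>
      K \<ge> 1 \<longrightarrow>
      extragradient n s d A r (dual s l b) \<gamma> K x xh y yh \<longrightarrow>
      gap2 (saddle n s d A r (dual s l b)) X Y
          (vec_average (total_dim n d) K xh) (vec_average s K yh)
        \<le> C * ((1 + sqrt lam + Ll + Lr) * sq_diameter X Y (x 0) (y 0) / real K))"
proof (intro exI[of _ "1::real"] conjI allI impI)
  fix n s :: nat and d :: "nat \<Rightarrow> nat" and A :: "nat \<Rightarrow> real mat" and b :: "real vec"
    and r :: "nat \<Rightarrow> real vec \<Rightarrow> real" and l :: "real vec \<Rightarrow> real vec \<Rightarrow> real"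
    and Lr Ll :: real and X Y :: "real vec set" and \<gamma> lam :: real
    and x xh y yh :: "nat \<Rightarrow> real vec" and K :: nat
  assume n: "n > 0" and d: "\<forall>i<n. d i > 0"
    and "\<forall>i<n. A i \<in> carrier_mat s (d i)"
    and g: "L_smooth s Ll (dual s l b)" "vconvex s (dual s l b)"
    and f: "L_smooth (total_dim n d) Lr (separable_sum n d r)"
      "vconvex (total_dim n d) (separable_sum n d r)"
    and X: "vcompact (total_dim n d) X" "X \<noteq> {}" and Y: "vcompact s Y" "Y \<noteq> {}"
    and lam: "lam = lambda_max (transpose_mat (concat_mat n s A) * concat_mat n s A)"
    and \<gamma>: "\<gamma> = stepsize lam Lr Ll" and K: "K \<ge> 1"
    and eg: "extragradient n s d A r (dual s l b) \<gamma> K x xh y yh"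
  let ?m = "total_dim n d" and ?f = "separable_sum n d r" and ?g = "dual s l b"
    and ?B = "concat_mat n s A"
  have A: "A i \<in> carrier_mat s (d i)" if "i < n" for i
    using that \<open>\<forall>i<n. A i \<in> carrier_mat s (d i)\<close> by blast
  have B: "?B \<in> carrier_mat s ?m" using A by (rule concat_mat_carrier)
  have m: "?m > 0" using n d by (rule total_dim_pos)
  have lam0: "0 \<le> lam" unfolding lam by (rule lambda_max_gram_nonneg[OF B m])
  have L: "0 < Lr" "0 < Ll" using f g by (auto simp: L_smooth_def)
  note step = stepsize_bounds[OF lam0 L, folded \<gamma>]
  have BM: "block_mult n s d A z = ?B *\<^sub>v z" if "z \<in> carrier_vec ?m" for z
    using A that by (rule block_mult_eq_concat_mat)
  have xc: "x k \<in> carrier_vec ?m" "y k \<in> carrier_vec s" if "k \<le> K" for k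
    using eg that by (simp_all add: extragradient_def)
  have hc: "xh k \<in> carrier_vec ?m" "yh k \<in> carrier_vec s" if "k < K" for k
    using eg that unfolding extragradient_def by blast+
  have xh: "xh k = x k - \<gamma> \<cdot>\<^sub>v (transpose_mat ?B *\<^sub>v y k + gradient ?m ?f (x k))"
    and x': "x (Suc k) = x k - \<gamma> \<cdot>\<^sub>v (transpose_mat ?B *\<^sub>v yh k + gradient ?m ?f (xh k))"
    and yh: "yh k = y k - \<gamma> \<cdot>\<^sub>v (gradient s ?g (y k) - ?B *\<^sub>v x k)"
    and y': "y (Suc k) = y k - \<gamma> \<cdot>\<^sub>v (gradient s ?g (yh k) - ?B *\<^sub>v xh k)" if k: "k < K" for k
  proof -
    \<comment> \<open>The iterate \<open>x (Suc k)\<close> is covered because \<open>k < K\<close>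
      gives \<open>Suc k \<le> K\<close>.\<close>
    have c: "x k \<in> carrier_vec ?m" "y k \<in> carrier_vec s" "x (Suc k) \<in> carrier_vec ?m"
      "xh k \<in> carrier_vec ?m" "yh k \<in> carrier_vec s"
      using xc[of k] xc[of "Suc k"] hc[OF k] k by auto
    note e = eg[unfolded extragradient_def, THEN conjunct2, rule_format, OF k]
    show "xh k = x k - \<gamma> \<cdot>\<^sub>v (transpose_mat ?B *\<^sub>v y k + gradient ?m ?f (x k))"
      using e by (intro block_update_eq[OF A f(1) c(1) c(1) c(4) c(2)]) auto
    show "x (Suc k) = x k - \<gamma> \<cdot>\<^sub>v (transpose_mat ?B *\<^sub>v yh k + gradient ?m ?f (xh k))"
      using e by (intro block_update_eq[OF A f(1) c(1) c(4) c(3) c(5)]) auto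
    show "yh k = y k - \<gamma> \<cdot>\<^sub>v (gradient s ?g (y k) - ?B *\<^sub>v x k)"
      "y (Suc k) = y k - \<gamma> \<cdot>\<^sub>v (gradient s ?g (yh k) - ?B *\<^sub>v xh k)"
      using e unfolding BM[OF c(1)] BM[OF c(4)] by auto
  qed
  have "gap2 (saddle n s d A r ?g) X Y (vec_average ?m K xh) (vec_average s K yh)
    \<le> (1 + sqrt lam + Ll + Lr) * sq_diameter X Y (x 0) (y 0) / real K"
  proof (rule gap2_leI[OF X(2) Y(2)])
    fix u v assume u: "u \<in> X" and v: "v \<in> Y"
    have uc: "u \<in> carrier_vec ?m" and vc: "v \<in> carrier_vec s"
      using u v X Y by (auto simp: vcompact_def)
    have xac: "vec_average ?m K xh \<in> carrier_vec ?m" using hc by simp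
    let ?D = "(vnorm (x 0 - u))\<^sup>2 + (vnorm (y 0 - v))\<^sup>2"
    have D: "?D \<le> sq_diameter X Y (x 0) (y 0)"
      by (rule sq_dist_le_sq_diameter[OF X(1) _ Y(1) _ u v]) (use xc in simp_all)
    have "saddle n s d A r ?g (vec_average ?m K xh) v - saddle n s d A r ?g u (vec_average s K yh)
      \<le> ?D / (2 * \<gamma>) / real K"
      unfolding saddle_def BM[OF uc] BM[OF xac] using K
      by (intro extragradient_average_gap_le[where x = x and y = y and xh = xh and yh = yh,
          OF B m lam f g step(1-4) _ xc hc xh yh x' y' uc vc]) auto
    also have "\<dots> = 1 / (2 * \<gamma>) * ?D / real K" by simp
    \<comment> \<open>The first factor is bounded by the stepsize estimate and the second by the
      squared diameter, which makes the bound independent of \<open>u\<close> and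
      \<open>v\<close>.\<close>
    also have "\<dots> \<le> (1 + sqrt lam + Ll + Lr) * sq_diameter X Y (x 0) (y 0) / real K"
      using step(5) D lam0 L by (intro divide_right_mono mult_mono) auto
    finally show "saddle n s d A r ?g (vec_average ?m K xh) v -
        saddle n s d A r ?g u (vec_average s K yh)
      \<le> (1 + sqrt lam + Ll + Lr) * sq_diameter X Y (x 0) (y 0) / real K" .
  qed
  then show "gap2 (saddle n s d A r ?g) X Y (vec_average ?m K xh) (vec_average s K yh)
    \<le> 1 * ((1 + sqrt lam + Ll + Lr) * sq_diameter X Y (x 0) (y 0) / real K)" by simp
qed simp

end
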